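(* Assume that the MPSC piecewise constant rank of subspace component condition (MPSC-PCRSC) holds at $\bar{x}\in\mathcal{F}$. Then the local error bound of (MPSC) holds at $\bar{x}$.
   Context: (MPSC) is the problem: minimize $f(x)$ over $x\in\mathbb{R}^n$ subject to $g_i(x)\le 0$ ($i=1,\dots,m$), $h_j(x)=0$ ($j=1,\dots,p$), $G_k(x)H_k(x)=0$ ($k=1,\dots,l$), where $f,g_i,h_j,G_k,H_k:\mathbb{R}^n\to\mathbb{R}$ are twice continuously differentiable. $\mathcal{F}$ denotes its feasible set. For a feasible point $\bar{x}$: $\mathcal{I}_h=\{1,\dots,p\}$, $\mathcal{I}_g=\{i: g_i(\bar{x})=0\}$, $\mathcal{I}_G=\{k: G_k(\bar{x})=0,\,H_k(\bar{x})\neq0\}$, $\mathcal{I}_H=\{k: G_k(\bar{x})\ne0,\,H_k(\bar{x})=0\}$, $\mathcal{I}_{GH}=\{k: G_k(\bar{x})=H_k(\bar{x})=0\}$. $\mathcal{P}(\mathcal{I}_{GH})$ is the set of all pairs $(\beta_1,\beta_2)$ of disjoint (possibly empty) sets with $\beta_1\cup\beta_2=\mathcal{I}_{GH}$. MPSC-PCRSC holds at $\bar{x}$ if for each $(\beta_1,\beta_2)\in\mathcal{P}(\mathcal{I}_{GH})$ there is $\varepsilon>0$ such that the rank of the family $\{\nabla g_i(x)\}_{i\in\mathcal{I}_g^-}\cup\{\nabla h_j(x)\}_{j\in\mathcal{I}_h}\cup\{\nabla G_k(x)\}_{k\in\mathcal{I}_G\cup\beta_1}\cup\{\nabla H_k(x)\}_{k\in\mathcal{I}_H\cup\beta_2}$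 is constant for all $x$ with $\|x-\bar{x}\|<\varepsilon$. Here $\mathcal{I}_g^-$ (depending on $(\beta_1,\beta_2)$) is the set of $r\in\mathcal{I}_g$ such that $-\nabla g_r(\bar{x})$ can be written as $\sum_{i\in\mathcal{I}_g\setminus\{r\}}\lambda_i\nabla g_i(\bar{x})+\sum_{j=1}^p\rho_j\nabla h_j(\bar{x})+\sum_{k\in\mathcal{I}_G\cup\beta_1}\mu_k\nabla G_k(\bar{x})+\sum_{k\in\mathcal{I}_H\cup\beta_2}\nu_k\nabla H_k(\bar{x})$ with $\lambda_i\ge0$ and $\rho_j,\mu_k,\nu_k\in\mathbb{R}$. The local error bound of (MPSC) holds at $\bar{x}$ if there exist $\varepsilon,\alpha>0$ such that for all $x$ with $\|x-\bar{x}\|<\varepsilon$, $$\mathrm{dist}_{\mathcal{F}}(x)\le\alpha\Big(\sum_{i=1}^m[g_i^+(x)]^2+\sum_{j=1}^p[h_j(x)]^2+\sum_{k=1}^l\min\{[G_k(x)]^2,[H_k(x)]^2\}\Big)^{1/2},$$ where $g_i^+(x)=\max\{g_i(x),0\}$ and $\mathrm{dist}_{\mathcal{F}}(x)=\inf_{y\in\mathcal{F}}\|x-y\|$ (Euclidean norm). *)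

theory Defs
  imports "HOL-Analysis.Analysis"
begin

section \<open>Gradients and smoothness\<close>

definition grad :: "(real^'n \<Rightarrow> real) \<Rightarrow> real^'n \<Rightarrow> real^'n" where
  "grad f x = (THE D. GDERIV f x :> D)"

text \<open>
  The function \<open>D\<close> is the gradient of \<open>f\<close> and \<open>B\<close> its Hessian matrix; both exist
  everywhere and the Hessian is continuous.
\<close>

definition twice_continuously_differentiable :: "(real^'n \<Rightarrow> real) \<Rightarrow> bool" where
  "twice_continuously_differentiable f \<longleftrightarrow>
     (\<exists>(D :: real^'n \<Rightarrow> real^'n) (B :: real^'n \<Rightarrow> real^'n^'n).
        (\<forall>x. GDERIV f x :> D x) \<and>
        (\<forall>x. (D has_derivative (\<lambda>v. B x *v v)) (at x)) \<and>
        continuous_on UNIV B)"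

section \<open>Mathematical programs with switching constraints\<close>

text \<open>
  Constraints are indexed from 1 as in the usual notation, so only \<open>ineq P i\<close> with
  \<open>i \<in> {1..num_ineq P}\<close> (and so on) matter; any of the three numbers may be 0.
\<close>

record 'n mpsc =
  obj :: "real^'n \<Rightarrow> real"
  num_ineq :: nat
  ineq :: "nat \<Rightarrow> real^'n \<Rightarrow> real"
  num_eq :: nat
  equ :: "nat \<Rightarrow> real^'n \<Rightarrow> real"
  num_switch :: nat
  swG :: "nat \<Rightarrow> real^'n \<Rightarrow> real"
  swH :: "nat \<Rightarrow> real^'n \<Rightarrow> real"

definition smooth_data :: "'n::finite mpsc \<Rightarrow> bool" where
  "smooth_data P \<longleftrightarrow>
     twice_continuously_differentiable (obj P) \<and>
     (\<forall>i\<in>{1..num_ineq P}. twice_continuously_differentiable (ineq P i)) \<and>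
     (\<forall>j\<in>{1..num_eq P}. twice_continuously_differentiable (equ P j)) \<and>
     (\<forall>k\<in>{1..num_switch P}. twice_continuously_differentiable (swG P k) \<and>
                              twice_continuously_differentiable (swH P k))"

definition feasible :: "'n::finite mpsc \<Rightarrow> (real^'n) set" where
  "feasible P = {x. (\<forall>i\<in>{1..num_ineq P}. ineq P i x \<le> 0) \<and>
                    (\<forall>j\<in>{1..num_eq P}. equ P j x = 0) \<and>
                    (\<forall>k\<in>{1..num_switch P}. swG P k x * swH P k x = 0)}"

definition Ih :: "'n::finite mpsc \<Rightarrow> nat set" where
  "Ih P = {1..num_eq P}"

definition Ig :: "'n::finite mpsc \<Rightarrow> real^'n \<Rightarrow> nat set" where
  "Ig P xb = {i\<in>{1..num_ineq P}. ineq P i xb = 0}"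

definition IG :: "'n::finite mpsc \<Rightarrow> real^'n \<Rightarrow> nat set" where
  "IG P xb = {k\<in>{1..num_switch P}. swG P k xb = 0 \<and> swH P k xb \<noteq> 0}"

definition IH :: "'n::finite mpsc \<Rightarrow> real^'n \<Rightarrow> nat set" where
  "IH P xb = {k\<in>{1..num_switch P}. swG P k xb \<noteq> 0 \<and> swH P k xb = 0}"

definition IGH :: "'n::finite mpsc \<Rightarrow> real^'n \<Rightarrow> nat set" where
  "IGH P xb = {k\<in>{1..num_switch P}. swG P k xb = 0 \<and> swH P k xb = 0}"

definition bipartitions :: "nat set \<Rightarrow> (nat set \<times> nat set) set" where
  "bipartitions I = {(\<beta>1, \<beta>2). \<beta>1 \<union> \<beta>2 = I \<and> \<beta>1 \<inter> \<beta>2 = {}}"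

section \<open>MPSC-PCRSC and the local error bound\<close>

definition Ig_minus ::
  "'n::finite mpsc \<Rightarrow> real^'n \<Rightarrow> nat set \<Rightarrow> nat set \<Rightarrow> nat set" where
  "Ig_minus P xb \<beta>1 \<beta>2 =
     {r \<in> Ig P xb. \<exists>\<kappa> \<rho> \<mu> \<nu> :: nat \<Rightarrow> real.
        (\<forall>i \<in> Ig P xb - {r}. \<kappa> i \<ge> 0) \<and>
        - grad (ineq P r) xb =
            (\<Sum>i \<in> Ig P xb - {r}. \<kappa> i *\<^sub>R grad (ineq P i) xb) +
            (\<Sum>j \<in> Ih P. \<rho> j *\<^sub>R grad (equ P j) xb) +
            (\<Sum>k \<in> IG P xb \<union> \<beta>1. \<mu> k *\<^sub>R grad (swG P k) xb) +
            (\<Sum>k \<in> IH P xb \<union> \<beta>2. \<nu> k *\<^sub>R grad (swH P k) xb)}"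

text \<open>
  All index sets are taken at \<open>xb\<close>, while the gradients are evaluated at \<open>x\<close>. Repeated
  vectors do not affect the rank, so the family is represented by its set of members and
  its rank is the library's \<open>dim\<close>, the dimension of the span.
\<close>

definition pcrsc_gradients ::
  "'n::finite mpsc \<Rightarrow> real^'n \<Rightarrow> nat set \<Rightarrow> nat set \<Rightarrow> real^'n \<Rightarrow> (real^'n) set" where
  "pcrsc_gradients P xb \<beta>1 \<beta>2 x =
     (\<lambda>i. grad (ineq P i) x) ` Ig_minus P xb \<beta>1 \<beta>2 \<union>
     (\<lambda>j. grad (equ P j) x) ` Ih P \<union>
     (\<lambda>k. grad (swG P k) x) ` (IG P xb \<union> \<beta>1) \<union>
     (\<lambda>k. grad (swH P k) x) ` (IH P xb \<union> \<beta>2)"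

definition MPSC_PCRSC :: "'n::finite mpsc \<Rightarrow> real^'n \<Rightarrow> bool" where
  "MPSC_PCRSC P xb \<longleftrightarrow>
     (\<forall>(\<beta>1, \<beta>2) \<in> bipartitions (IGH P xb). \<exists>\<epsilon>>0.
        (\<lambda>x. dim (pcrsc_gradients P xb \<beta>1 \<beta>2 x)) constant_on {x. norm (x - xb) < \<epsilon>})"

text \<open>
  \<open>infdist\<close> agrees with the infimum of the distances on nonempty sets and is 0 for the
  empty set; the bound is only used at feasible points, where \<open>feasible P\<close> is nonempty.
\<close>

definition local_error_bound :: "'n::finite mpsc \<Rightarrow> real^'n \<Rightarrow> bool" where
  "local_error_bound P xb \<longleftrightarrow>
     (\<exists>\<epsilon>>0. \<exists>\<alpha>>0. \<forall>x. norm (x - xb) < \<epsilon> \<longrightarrow>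
        infdist x (feasible P) \<le> \<alpha> * sqrt (
          (\<Sum>i\<in>{1..num_ineq P}. (max (ineq P i x) 0)\<^sup>2) +
          (\<Sum>j\<in>{1..num_eq P}. (equ P j x)\<^sup>2) +
          (\<Sum>k\<in>{1..num_switch P}. min ((swG P k x)\<^sup>2) ((swH P k x)\<^sup>2))))"

end

theory Submission
  imports Defs
begin

text \<open>
  Near \<open>xb\<close> the feasible set contains the feasible set of the ordinary nonlinear program obtained
  from any partition \<open>(\<beta>1, \<beta>2)\<close> of the biactive switching indices, where \<open>G\<^sub>k = 0\<close> is imposed on
  \<open>IG \<union> \<beta>1\<close> and \<open>H\<^sub>k = 0\<close> on \<open>IH \<union> \<beta>2\<close>. For a given point \<open>x\<close> choose the partition that puts each
  biactive \<open>k\<close> on the side where the switching function is smaller in absolute value at \<open>x\<close>: then the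
  constraint violation of that program at \<open>x\<close> is at most a constant times the violation in the error
  bound to be proved. As there are only finitely many partitions, it suffices to prove the error
  bound for one such program, with active inequalities \<open>g\<^sub>i \<le> 0\<close> (\<open>i \<in> A\<close>) and equations \<open>h\<^sub>j = 0\<close>
  (\<open>j \<in> B\<close>). Let \<open>J \<subseteq> A\<close> be the inequalities singled out by the subspace component.

  Constant rank of the gradients of \<open>g\<^sub>J\<close> and \<open>h\<close> makes these functions, near the reference point,
  functions of a subfamily with independent gradients. Hence a nearby \<open>x\<close> can be moved onto
  \<open>{g\<^sub>J = 0, h = 0}\<close> over a distance of order \<open>\<Sum>\<bar>g\<^sub>J x\<bar> + \<Sum>\<bar>h x\<bar>\<close>
  (\<open>constant_rank_retraction\<close>).

  This residual still punishes \<open>g\<^sub>i x < 0\<close> for \<open>i \<in> J\<close>. By the definition of \<open>J\<close> there are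
  \<open>\<kappa>\<^sub>i \<ge> 1\<close> such that \<open>L = \<Sum>\<kappa>\<^sub>i g\<^sub>i + \<Sum>\<rho>\<^sub>j h\<^sub>j\<close> has gradient zero at the reference point
  (\<open>positive_relation\<close>). Since \<open>L\<close> vanishes at the retracted point, \<open>\<bar>L x\<bar>\<close> is at most an arbitrarily
  small multiple of the retraction distance, so negative values of \<open>g\<^sub>J\<close> must be balanced by positive
  ones or by \<open>h\<close>; the two-sided residual is therefore controlled by the one-sided one
  (\<open>implicit_residual_bound\<close>).

  For the remaining inequalities, separation gives a direction that is tangent to \<open>{g\<^sub>J = 0, h = 0}\<close> to
  first order and strictly decreases every \<open>g\<^sub>i\<close> with \<open>i \<in> A - J\<close> (\<open>descent_direction\<close>). Retracting,
  moving along this direction by a multiple of the residual, and retracting again yields a feasible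
  point at a distance of the order of the residual (\<open>error_bound\<close>).
\<close>

section \<open>Local first-order estimates\<close>

text \<open>
  A continuous gradient makes the error of the first-order expansion small relative to the distance
  of two points that both vary: apply the mean value inequality to \<open>f\<close> minus its linearization.
\<close>

lemma strict_differentiability:
  fixes f :: "'a::euclidean_space \<Rightarrow> real"
  assumes der: "\<And>x. GDERIV f x :> D x" and cont: "continuous_on UNIV D" and "e > 0"
  shows "\<exists>\<delta>>0. \<forall>x\<in>ball x0 \<delta>. \<forall>y\<in>ball x0 \<delta>. \<bar>f y - f x - (y - x) \<bullet> D x0\<bar> \<le> e * dist x y"
proof -
  from cont have "isCont D x0" by (simp add: continuous_on_eq_continuous_at)
  then obtain \<delta> where \<delta>: "\<delta> > 0" "\<And>x. dist x x0 < \<delta> \<Longrightarrow> dist (D x) (D x0) < e"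
    unfolding continuous_at_eps_delta using \<open>e > 0\<close> by blast
  have "\<bar>f y - f x - (y - x) \<bullet> D x0\<bar> \<le> e * dist x y" if x: "x \<in> ball x0 \<delta>" and y: "y \<in> ball x0 \<delta>" for x y
  proof -
    have "norm ((f y - y \<bullet> D x0) - (f x - x \<bullet> D x0)) \<le> e * norm (y - x)"
    proof (rule differentiable_bound[of "ball x0 \<delta>" _ "\<lambda>x h. h \<bullet> D x - h \<bullet> D x0"])
      show "((\<lambda>y. f y - y \<bullet> D x0) has_derivative (\<lambda>h. h \<bullet> D z - h \<bullet> D x0)) (at z within ball x0 \<delta>)"
        for z
        using der[of z] unfolding gderiv_def
        by (auto intro!: derivative_eq_intros intro: has_derivative_at_withinI)
      show "onorm (\<lambda>h. h \<bullet> D z - h \<bullet> D x0) \<le> e" if "z \<in> ball x0 \<delta>" for z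
      proof (rule onorm_le)
        fix h
        have "norm (h \<bullet> D z - h \<bullet> D x0) \<le> norm h * norm (D z - D x0)"
          unfolding inner_diff_right[symmetric] by (metis Cauchy_Schwarz_ineq2 real_norm_def)
        also have "\<dots> \<le> norm h * e"
          using \<delta>(2)[of z] that by (intro mult_left_mono) (auto simp: dist_norm norm_minus_commute)
        finally show "norm (h \<bullet> D z - h \<bullet> D x0) \<le> e * norm h" by (simp add: mult.commute)
      qed
    qed (use x y in auto)
    then show ?thesis by (simp add: inner_diff_left dist_norm norm_minus_commute algebra_simps)
  qed
  with \<open>\<delta> > 0\<close> show ?thesis by blast
qed

lemma uniform_strict_differentiability:
  fixes f :: "'k \<Rightarrow> 'a::euclidean_space \<Rightarrow> real"
  assumes fin: "finite K" and der: "\<And>k x. k \<in> K \<Longrightarrow> GDERIV (f k) x :> D k x"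
    and cont: "\<And>k. k \<in> K \<Longrightarrow> continuous_on UNIV (D k)" and "e > 0"
  obtains \<delta> where "\<delta> > 0" "\<And>k x y. k \<in> K \<Longrightarrow> x \<in> ball p \<delta> \<Longrightarrow> y \<in> ball p \<delta> \<Longrightarrow>
    \<bar>f k y - f k x - (y - x) \<bullet> D k p\<bar> \<le> e * dist x y"
proof -
  have "\<forall>k\<in>K. \<exists>\<delta>>0. \<forall>x\<in>ball p \<delta>. \<forall>y\<in>ball p \<delta>. \<bar>f k y - f k x - (y - x) \<bullet> D k p\<bar> \<le> e * dist x y"
    using strict_differentiability[OF der cont \<open>e > 0\<close>, of _ p] by blast
  then obtain \<delta> where \<delta>: "\<And>k. k \<in> K \<Longrightarrow> \<delta> k > 0"
     "\<And>k x y. k \<in> K \<Longrightarrow> x \<in> ball p (\<delta> k) \<Longrightarrow> y \<in> ball p (\<delta> k) \<Longrightarrow>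
       \<bar>f k y - f k x - (y - x) \<bullet> D k p\<bar> \<le> e * dist x y"
    by metis
  define \<delta>0 where "\<delta>0 = Min (insert 1 (\<delta> ` K))"
  have "\<delta>0 > 0" "\<And>k. k \<in> K \<Longrightarrow> \<delta>0 \<le> \<delta> k"
    using fin \<delta>(1) by (auto simp: \<delta>0_def)
  then have "x \<in> ball p (\<delta> k)" if "k \<in> K" "x \<in> ball p \<delta>0" for k x
    using that by (auto intro: less_le_trans)
  then show ?thesis using \<delta>(2) \<open>\<delta>0 > 0\<close> that by blast
qed

text \<open>
  The coordinate functionals of an independent set, represented by inner products.
\<close>

lemma dual_vectors:
  fixes S :: "'a::euclidean_space set"
  assumes "independent S"
  obtains b where "\<And>x y. x \<in> S \<Longrightarrow> y \<in> S \<Longrightarrow> x \<bullet> b y = (if x = y then 1 else 0)"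
proof -
  have "\<exists>v. \<forall>x\<in>S. x \<bullet> v = (if x = y then 1 else 0)" for y
  proof -
    obtain g :: "'a \<Rightarrow> real" where g: "linear g" "\<forall>x\<in>S. g x = (if x = y then 1 else 0)"
      using linear_independent_extend[OF assms, of "\<lambda>x. if x = y then 1 else 0"] by blast
    then show ?thesis using adjoint_works[OF g(1), of _ 1] by (intro exI[of _ "adjoint g 1"]) auto
  qed
  then show ?thesis using that by metis
qed

lemma isCont_imp_tendsto_nhds: "isCont f x \<Longrightarrow> (f \<longlongrightarrow> f x) (nhds x)"
  by (simp only: isCont_def tendsto_at_iff_tendsto_nhds)

text \<open>
  Points that are moved by a vanishing amount remain in any neighbourhood. This keeps retracted
  points inside the region where the local estimates hold.
\<close>

lemma eventually_nearby:
  fixes x0 :: "'a::metric_space"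
  assumes "eventually P (nhds x0)" and "(\<rho> \<longlongrightarrow> 0) (nhds x0)"
  shows "eventually (\<lambda>x. \<forall>z. dist x z \<le> \<rho> x \<longrightarrow> P z) (nhds x0)"
proof -
  obtain d where d: "d > 0" "\<And>z. dist z x0 < d \<Longrightarrow> P z"
    using assms(1) unfolding eventually_nhds_metric by blast
  have "eventually (\<lambda>x. dist x x0 < d/2) (nhds x0)"
    using d(1) by (auto simp: eventually_nhds_metric intro!: exI[of _ "d/2"])
  moreover have "eventually (\<lambda>x. \<rho> x < d/2) (nhds x0)"
    using order_tendstoD(2)[OF assms(2), of "d/2"] d(1) by simp
  ultimately show ?thesis
  proof eventually_elim
    case (elim x)
    show ?case
    proof (intro allI impI)
      fix z assume "dist x z \<le> \<rho> x"
      with elim have "dist z x0 < d"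
        using dist_triangle[of z x0 x] by (simp add: dist_commute)
      then show "P z" by (rule d(2))
    qed
  qed
qed

section \<open>Retraction onto the common zeros of a family of constant rank\<close>

text \<open>
  Choose \<open>U \<subseteq> K\<close> whose gradients \<open>a\<^sub>k\<close> at \<open>x0\<close> form a basis of the span, with dual vectors \<open>b\<^sub>k\<close>.
  The map \<open>\<Phi>\<close> replaces the coordinate of \<open>x - x0\<close> along \<open>b\<^sub>k\<close> by \<open>F\<^sub>k x\<close>, so its derivative at \<open>x0\<close> is
  the identity and it has a local inverse \<open>g\<close>. By constancy of the rank the gradients in \<open>U\<close> span
  all gradients near \<open>x0\<close>, so every \<open>F\<^sub>k\<close> is constant along curves on which all \<open>F\<^sub>j\<close> with
  \<open>j \<in> U\<close> are constant. Setting the \<open>U\<close>-coordinates of \<open>\<Phi> x\<close> to zero and mapping back therefore gives a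
  common zero of the whole family; the step is bounded because \<open>\<Phi>\<close> is a small perturbation of a translation.
\<close>

lemma constant_rank_retraction:
  fixes F :: "'k \<Rightarrow> 'a::euclidean_space \<Rightarrow> real"
  assumes fin: "finite K"
    and der: "\<And>k x. k \<in> K \<Longrightarrow> GDERIV (F k) x :> D k x"
    and cont: "\<And>k. k \<in> K \<Longrightarrow> continuous_on UNIV (D k)"
    and zero: "\<And>k. k \<in> K \<Longrightarrow> F k x0 = 0"
    and rank: "eventually (\<lambda>x. dim ((\<lambda>k. D k x) ` K) = r) (nhds x0)"
  obtains C where "C > 0"
    "eventually (\<lambda>x. \<exists>z. (\<forall>k\<in>K. F k z = 0) \<and> dist x z \<le> C * (\<Sum>k\<in>K. \<bar>F k x\<bar>)) (nhds x0)"
proof -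
  obtain B where B: "B \<subseteq> (\<lambda>k. D k x0) ` K" "independent B" "card B = dim ((\<lambda>k. D k x0) ` K)"
    by (metis basis_exists)
  from B(1) obtain U where U: "U \<subseteq> K" "inj_on (\<lambda>k. D k x0) U" "B = (\<lambda>k. D k x0) ` U"
    by (auto simp: subset_image_inj)
  have finU: "finite U" using U(1) fin finite_subset by blast
  define a where "a k = D k x0" for k
  obtain b' where b': "\<And>x y. x \<in> B \<Longrightarrow> y \<in> B \<Longrightarrow> x \<bullet> b' y = (if x = y then 1 else 0)"
    using dual_vectors[OF B(2)] by blast
  define b where "b k = b' (a k)" for k
  have dual: "a j \<bullet> b k = (if j = k then 1 else 0)" if "j \<in> U" "k \<in> U" for j k
    using that b'[of "a j" "a k"] U(2,3) by (auto simp: a_def b_def inj_on_def)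
  have a_sum: "a j \<bullet> (\<Sum>k\<in>U. c k *\<^sub>R b k) = c j" if "j \<in> U" for j c
    using that finU by (simp add: inner_sum_right dual if_distrib[of "\<lambda>x. _ * x"] cong: if_cong)
  define \<Phi> where "\<Phi> x = x - x0 + (\<Sum>k\<in>U. (F k x - (x - x0) \<bullet> a k) *\<^sub>R b k)" for x
  define \<Phi>' where "\<Phi>' x = id_blinfun + (\<Sum>k\<in>U. blinfun_scaleR_left (b k) o\<^sub>L blinfun_inner_left (D k x - a k))" for x
  have \<Phi>'_apply: "blinfun_apply (\<Phi>' x) w = w + (\<Sum>k\<in>U. (w \<bullet> (D k x - a k)) *\<^sub>R b k)" for x w
    by (simp add: \<Phi>'_def blinfun.add_left blinfun.sum_left)
  have \<Phi>_der: "(\<Phi> has_derivative blinfun_apply (\<Phi>' x)) (at x)" for x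
  proof -
    have "((\<lambda>x. x - x0 + (\<Sum>k\<in>U. (F k x - (x - x0) \<bullet> a k) *\<^sub>R b k)) has_derivative
          (\<lambda>w. w - 0 + (\<Sum>k\<in>U. (w \<bullet> D k x - (w - 0) \<bullet> a k) *\<^sub>R b k))) (at x)"
      using der U(1) unfolding gderiv_def
      by (intro has_derivative_add has_derivative_sum has_derivative_scaleR_left has_derivative_diff
          has_derivative_inner_left has_derivative_ident has_derivative_const) auto
    then show ?thesis
      unfolding \<Phi>_def[abs_def] \<Phi>'_apply[abs_def] by (simp add: inner_diff_right)
  qed
  have \<Phi>'_cont: "continuous_on W \<Phi>'" for W
    unfolding \<Phi>'_def[abs_def]
    using cont U(1)
    by (intro continuous_intros bounded_linear.continuous_on[OF bounded_linear_blinfun_inner_left])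
       (auto intro: continuous_on_subset)
  have \<Phi>_x0: "\<Phi> x0 = 0" using zero U(1) by (auto simp: \<Phi>_def intro!: sum.neutral)
  have coord: "a j \<bullet> \<Phi> x = F j x" if "j \<in> U" for j x
    unfolding \<Phi>_def inner_add_right a_sum[OF that] by (simp add: inner_commute)
  have coord': "a j \<bullet> blinfun_apply (\<Phi>' x) w = w \<bullet> D j x" if "j \<in> U" for j x w
    unfolding \<Phi>'_apply inner_add_right a_sum[OF that] by (simp add: inner_commute inner_diff_right)
  obtain W where W: "open W" "x0 \<in> W" "\<And>x. x \<in> W \<Longrightarrow> dim ((\<lambda>k. D k x) ` K) = r"
    using rank unfolding eventually_nhds by blast
  have "id_blinfun o\<^sub>L \<Phi>' x0 = id_blinfun"
    by (rule blinfun_eqI) (simp add: \<Phi>'_apply a_def)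
  then obtain U' V g g' where inv: "open U'" "U' \<subseteq> W" "x0 \<in> U'" "open V" "0 \<in> V"
      "homeomorphism U' V \<Phi> g"
      "\<And>y. y \<in> V \<Longrightarrow> (g has_derivative g' y) (at y)"
      "\<And>y. y \<in> V \<Longrightarrow> g' y = inv (blinfun_apply (\<Phi>' (g y)))"
      "\<And>y. y \<in> V \<Longrightarrow> bij (blinfun_apply (\<Phi>' (g y)))"
    using inverse_function_theorem[of W \<Phi> \<Phi>' x0 id_blinfun] W \<Phi>_der \<Phi>'_cont \<Phi>_x0 by metis
  have g0: "g 0 = x0" using homeomorphism_apply1[OF inv(6) inv(3)] \<Phi>_x0 by simp
  \<comment> \<open>\<open>D j x\<close> is the image of \<open>a j\<close> under the adjoint of the map \<open>\<Phi>' x\<close>, which is invertible for \<open>x = g y\<close>, so the gradients in \<open>U\<close> keep their rank; equality of dimensions then gives equality of spans.\<close>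
  have in_span: "D k (g y) \<in> span ((\<lambda>j. D j (g y)) ` U)" if "y \<in> V" "k \<in> K" for k y
  proof -
    let ?M = "blinfun_apply (\<Phi>' (g y))"
    have lin: "linear ?M" by (rule bounded_linear.linear[OF blinfun.bounded_linear_right])
    have gW: "g y \<in> W" using inv(2) homeomorphism_image2[OF inv(6)] that(1) by blast
    have adj: "D j (g y) = adjoint ?M (a j)" if "j \<in> U" for j
    proof (rule vector_eq_ldot[THEN iffD1], intro allI)
      fix w show "w \<bullet> D j (g y) = w \<bullet> adjoint ?M (a j)"
        using adjoint_works[OF lin, of w "a j"] coord'[OF that, of "g y" w] by (simp add: inner_commute)
    qed
    have inj: "inj (adjoint ?M)"
    proof (rule linear_injective_0[OF adjoint_linear[OF lin], THEN iffD2], intro allI impI)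
      fix v assume v: "adjoint ?M v = 0"
      have "surj ?M" using inv(9)[OF that(1)] by (rule bij_is_surj)
      then obtain w where "?M w = v" by (metis surjD)
      then show "v = 0" using adjoint_works[OF lin, of w v] v by simp
    qed
    have "(\<lambda>j. D j (g y)) ` U = adjoint ?M ` B"
      unfolding U(3) image_image using adj by (auto simp: a_def)
    then have "dim ((\<lambda>j. D j (g y)) ` U) = dim B"
      using dim_image_eq[OF adjoint_linear[OF lin], of B] inj by (simp add: inj_on_subset)
    also have "\<dots> = dim ((\<lambda>k. D k x0) ` K)"
      using B(2,3) by (simp add: dim_eq_card_independent)
    also have "\<dots> = dim ((\<lambda>k. D k (g y)) ` K)"
      using W(3)[OF W(2)] W(3)[OF gW] by simp
    finally have "span ((\<lambda>j. D j (g y)) ` U) = span ((\<lambda>k. D k (g y)) ` K)"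
      using U(1) by (intro dim_eq_span) auto
    then show ?thesis using that(2) by (simp add: span_base)
  qed
  obtain \<epsilon> where \<epsilon>: "\<epsilon> > 0" "ball 0 \<epsilon> \<subseteq> V"
    using inv(4,5) open_contains_ball by blast
  \<comment> \<open>Along the segment from \<open>0\<close> to \<open>y\<close> the functions in \<open>U\<close> do not change, hence neither does \<open>F k\<close>.\<close>
  have vanish: "F k (g y) = 0" if y: "y \<in> ball 0 \<epsilon>" and orth: "\<And>j. j \<in> U \<Longrightarrow> a j \<bullet> y = 0" and k: "k \<in> K" for y k
  proof -
    have inV: "t *\<^sub>R y \<in> V" if "0 \<le> t" "t \<le> 1" for t
    proof -
      have "norm (t *\<^sub>R y) \<le> norm y" using that by (simp add: mult_left_le_one_le)
      then show ?thesis using y \<epsilon>(2) by auto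
    qed
    have d: "((\<lambda>t. F k (g (t *\<^sub>R y))) has_real_derivative 0) (at t)" if t: "0 \<le> t" "t \<le> 1" for t
    proof -
      let ?z = "t *\<^sub>R y"
      have z: "?z \<in> V" using inV[OF t] .
      have "((\<lambda>t. t *\<^sub>R y) has_derivative (\<lambda>h. h *\<^sub>R y)) (at t)"
        by (auto intro!: derivative_eq_intros)
      from has_derivative_compose[OF has_derivative_compose[OF this inv(7)[OF z]]]
      have "((\<lambda>t. F k (g (t *\<^sub>R y))) has_derivative (\<lambda>h. g' ?z (h *\<^sub>R y) \<bullet> D k (g ?z))) (at t)"
        using der[OF k, of "g ?z"] unfolding gderiv_def by blast
      moreover have "g' ?z (h *\<^sub>R y) \<bullet> D k (g ?z) = 0" for h
      proof -
        have "blinfun_apply (\<Phi>' (g ?z)) (g' ?z (h *\<^sub>R y)) = h *\<^sub>R y"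
          unfolding inv(8)[OF z] using inv(9)[OF z] by (meson bij_inv_eq_iff)
        then have "g' ?z (h *\<^sub>R y) \<bullet> D j (g ?z) = 0" if "j \<in> U" for j
          using coord'[OF that, of "g ?z" "g' ?z (h *\<^sub>R y)"] orth[OF that] by simp
        then have "orthogonal (g' ?z (h *\<^sub>R y)) (D k (g ?z))"
          by (intro orthogonal_to_span[OF in_span[OF z k]]) (auto simp: orthogonal_def)
        then show ?thesis by (simp add: orthogonal_def)
      qed
      ultimately show ?thesis by (simp add: has_field_derivative_def lambda_zero)
    qed
    obtain c where "\<And>t. t \<in> {0..1} \<Longrightarrow> F k (g (t *\<^sub>R y)) = c"
      using has_field_derivative_zero_constant[of "{0..1::real}" "\<lambda>t. F k (g (t *\<^sub>R y))"]
        has_field_derivative_at_within[OF d] by auto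
    from this[of 1] this[of 0] have "F k (g (1 *\<^sub>R y)) = F k (g (0 *\<^sub>R y))" by simp
    then show ?thesis using g0 zero[OF k] by simp
  qed
  define M where "M = (\<Sum>k\<in>U. norm (b k))"
  have M0: "M \<ge> 0" by (simp add: M_def sum_nonneg)
  define e where "e = 1 / (2 * (M + 1))"
  have e: "e > 0" "e * M \<le> 1/2" using M0 by (auto simp: e_def field_simps)
  obtain \<delta> where \<delta>: "\<delta> > 0" "\<And>k x y. k \<in> U \<Longrightarrow> x \<in> ball x0 \<delta> \<Longrightarrow> y \<in> ball x0 \<delta> \<Longrightarrow>
      \<bar>F k y - F k x - (y - x) \<bullet> a k\<bar> \<le> e * dist x y"
    using uniform_strict_differentiability[where K = U and f = F and D = D and p = x0, OF finU _ _ e(1)]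
      der cont U(1) unfolding a_def by blast
  \<comment> \<open>The choice of \<open>e\<close> makes \<open>\<Phi>\<close> minus the identity a contraction with constant \<open>1/2\<close>.\<close>
  have lip: "dist x y \<le> 2 * dist (\<Phi> x) (\<Phi> y)" if "x \<in> ball x0 \<delta>" "y \<in> ball x0 \<delta>" for x y
  proof -
    have "\<Phi> y - \<Phi> x - (y - x) = (\<Sum>k\<in>U. (F k y - F k x - (y - x) \<bullet> a k) *\<^sub>R b k)"
      unfolding \<Phi>_def by (simp add: sum_subtractf[symmetric] scaleR_diff_left[symmetric] inner_diff_left algebra_simps)
    also have "norm \<dots> \<le> (\<Sum>k\<in>U. (e * dist x y) * norm (b k))"
    proof (rule sum_norm_le)
      fix k assume k: "k \<in> U"
      then show "norm ((F k y - F k x - (y - x) \<bullet> a k) *\<^sub>R b k) \<le> (e * dist x y) * norm (b k)"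
        using \<delta>(2)[OF k, of x y] that
        by (simp add: mult_right_mono)
    qed
    also have "\<dots> = (e * M) * dist x y" by (simp add: M_def sum_distrib_left mult_ac)
    also have "\<dots> \<le> 1/2 * dist x y" using e(2) by (intro mult_right_mono) auto
    finally have "norm (y - x) \<le> norm (\<Phi> y - \<Phi> x) + 1/2 * dist x y"
      using norm_triangle_ineq4[of "\<Phi> y - \<Phi> x" "\<Phi> y - \<Phi> x - (y - x)"] by simp
    then show ?thesis by (simp add: dist_norm norm_minus_commute)
  qed
  \<comment> \<open>\<open>Q x\<close> is \<open>\<Phi> x\<close> with its \<open>U\<close>-coordinates set to zero; \<open>g (Q x)\<close> is the retracted point.\<close>
  define Q where "Q x = \<Phi> x - (\<Sum>k\<in>U. F k x *\<^sub>R b k)" for x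
  have "isCont Q x0"
    unfolding Q_def
    by (intro continuous_intros has_derivative_continuous[OF \<Phi>_der] has_derivative_continuous[OF der[unfolded gderiv_def]])
       (use U(1) in auto)
  moreover have Q0: "Q x0 = 0" using \<Phi>_x0 zero U(1) by (auto simp: Q_def intro!: sum.neutral)
  ultimately have Qlim: "(Q \<longlongrightarrow> 0) (nhds x0)"
    using isCont_imp_tendsto_nhds by fastforce
  have "isCont g 0" using inv(7)[OF inv(5)] by (rule has_derivative_continuous)
  then have "(g \<longlongrightarrow> x0) (nhds 0)"
    using isCont_imp_tendsto_nhds g0 by fastforce
  then have gQlim: "((\<lambda>x. g (Q x)) \<longlongrightarrow> x0) (nhds x0)"
    using Qlim by (rule filterlim_compose)
  have evQ: "eventually (\<lambda>x. Q x \<in> ball 0 \<epsilon>) (nhds x0)"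
    by (rule topological_tendstoD[OF Qlim open_ball]) (simp add: \<epsilon>(1))
  have evg: "eventually (\<lambda>x. g (Q x) \<in> ball x0 \<delta>) (nhds x0)"
    by (rule topological_tendstoD[OF gQlim open_ball]) (simp add: \<delta>(1))
  have evx: "eventually (\<lambda>x. x \<in> ball x0 \<delta>) (nhds x0)"
    using \<delta>(1) by (intro eventually_nhds_in_open) auto
  have "eventually (\<lambda>x. \<exists>z. (\<forall>k\<in>K. F k z = 0) \<and> dist x z \<le> (2 * M + 1) * (\<Sum>k\<in>K. \<bar>F k x\<bar>)) (nhds x0)"
    using evQ evg evx
  proof eventually_elim
    case (elim x)
    note Qb = elim(1) and gb = elim(2) and xb = elim(3)
    have orth: "a j \<bullet> Q x = 0" if "j \<in> U" for j
      unfolding Q_def inner_diff_right a_sum[OF that] coord[OF that] by simp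
    have "dist x (g (Q x)) \<le> 2 * dist (\<Phi> x) (\<Phi> (g (Q x)))" by (rule lip[OF xb gb])
    also have "\<Phi> (g (Q x)) = Q x" using homeomorphism_apply2[OF inv(6)] Qb \<epsilon>(2) by blast
    also have "dist (\<Phi> x) (Q x) = norm (\<Sum>k\<in>U. F k x *\<^sub>R b k)" by (simp add: Q_def dist_norm)
    also have "\<dots> \<le> (\<Sum>k\<in>U. (\<Sum>k\<in>K. \<bar>F k x\<bar>) * norm (b k))"
    proof (rule sum_norm_le)
      fix k assume "k \<in> U"
      then have "\<bar>F k x\<bar> \<le> (\<Sum>k\<in>K. \<bar>F k x\<bar>)" using U(1) fin by (intro member_le_sum) auto
      then show "norm (F k x *\<^sub>R b k) \<le> (\<Sum>k\<in>K. \<bar>F k x\<bar>) * norm (b k)"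
        by (simp add: mult_right_mono)
    qed
    also have "\<dots> = (\<Sum>k\<in>K. \<bar>F k x\<bar>) * M" by (simp only: M_def sum_distrib_left)
    finally have "dist x (g (Q x)) \<le> 2 * M * (\<Sum>k\<in>K. \<bar>F k x\<bar>)" by (simp add: mult_ac)
    also have "\<dots> \<le> (2 * M + 1) * (\<Sum>k\<in>K. \<bar>F k x\<bar>)"
      by (intro mult_right_mono) (auto simp: sum_nonneg)
    finally show ?case using vanish[OF Qb orth] by (intro exI[of _ "g (Q x)"]) auto
  qed
  then show ?thesis using M0 by (intro that[of "2 * M + 1"]) auto
qed

section \<open>Inequalities that are implicit equalities\<close>

text \<open>
  The subspace component for abstract gradients: \<open>v\<close> lists the gradients of the active inequalities
  and \<open>w\<close> those of the equations. Along directions that satisfy the linearized constraints these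
  inequalities can only hold with equality.
\<close>

definition implicit_equalities ::
  "'i set \<Rightarrow> 'j set \<Rightarrow> ('i \<Rightarrow> 'a::euclidean_space) \<Rightarrow> ('j \<Rightarrow> 'a) \<Rightarrow> 'i set" where
  "implicit_equalities A B v w =
     {r \<in> A. \<exists>\<kappa> \<rho>. (\<forall>i\<in>A - {r}. 0 \<le> \<kappa> i) \<and>
        - v r = (\<Sum>i\<in>A - {r}. \<kappa> i *\<^sub>R v i) + (\<Sum>j\<in>B. \<rho> j *\<^sub>R w j)}"

text \<open>
  If \<open>- v r\<close> lies outside the cone generated by the other \<open>v i\<close> and by \<open>\<plusminus> w j\<close>, then, finitely
  generated cones being closed, a hyperplane separates it from that cone.
\<close>

lemma separating_direction:
  fixes v :: "'i \<Rightarrow> 'a::euclidean_space"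
  assumes fin: "finite A" "finite B" and r: "r \<in> A" "r \<notin> implicit_equalities A B v w"
  obtains d where "v r \<bullet> d = -1" "\<And>i. i \<in> A \<Longrightarrow> v i \<bullet> d \<le> 0" "\<And>j. j \<in> B \<Longrightarrow> w j \<bullet> d = 0"
proof -
  define T where "T = v ` (A - {r}) \<union> w ` B \<union> (\<lambda>j. - w j) ` B"
  define Kc where "Kc = {(\<Sum>i\<in>A - {r}. \<kappa> i *\<^sub>R v i) + (\<Sum>j\<in>B. \<rho> j *\<^sub>R w j) |\<kappa> \<rho>. \<forall>i\<in>A - {r}. 0 \<le> \<kappa> i}"
  have KcI: "(\<Sum>i\<in>A - {r}. \<kappa> i *\<^sub>R v i) + (\<Sum>j\<in>B. \<rho> j *\<^sub>R w j) \<in> Kc" if "\<forall>i\<in>A - {r}. 0 \<le> \<kappa> i" for \<kappa> \<rho>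
    using that unfolding Kc_def by blast
  have "convex_cone Kc"
    unfolding convex_cone_iff
  proof (intro conjI ballI allI impI)
    show "0 \<in> Kc" using KcI[of "\<lambda>_. 0" "\<lambda>_. 0"] by simp
  next
    fix x y assume "x \<in> Kc" "y \<in> Kc"
    then obtain \<kappa> \<rho> \<kappa>' \<rho>' where
      xy: "x = (\<Sum>i\<in>A - {r}. \<kappa> i *\<^sub>R v i) + (\<Sum>j\<in>B. \<rho> j *\<^sub>R w j)" "\<forall>i\<in>A - {r}. 0 \<le> \<kappa> i"
          "y = (\<Sum>i\<in>A - {r}. \<kappa>' i *\<^sub>R v i) + (\<Sum>j\<in>B. \<rho>' j *\<^sub>R w j)" "\<forall>i\<in>A - {r}. 0 \<le> \<kappa>' i"
      unfolding Kc_def by blast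
    show "x + y \<in> Kc"
      using KcI[of "\<lambda>i. \<kappa> i + \<kappa>' i" "\<lambda>j. \<rho> j + \<rho>' j"] xy
      by (simp add: scaleR_add_left sum.distrib algebra_simps)
  next
    fix x and c :: real assume "x \<in> Kc" "0 \<le> c"
    then obtain \<kappa> \<rho> where
      x: "x = (\<Sum>i\<in>A - {r}. \<kappa> i *\<^sub>R v i) + (\<Sum>j\<in>B. \<rho> j *\<^sub>R w j)" "\<forall>i\<in>A - {r}. 0 \<le> \<kappa> i"
      unfolding Kc_def by blast
    show "c *\<^sub>R x \<in> Kc"
      using KcI[of "\<lambda>i. c * \<kappa> i" "\<lambda>j. c * \<rho> j"] x \<open>0 \<le> c\<close>
      by (simp add: scaleR_add_right scaleR_sum_right)
  qed
  moreover have "T \<subseteq> Kc"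
  proof -
    have delta: "(\<Sum>i\<in>S. (if i = k then c else 0) *\<^sub>R u i) = c *\<^sub>R u k" if "finite S" "k \<in> S" for S k c and u :: "'z \<Rightarrow> 'a"
      using that by (simp add: if_distrib[of "\<lambda>x. x *\<^sub>R _"] cong: if_cong)
    have "v k \<in> Kc" if "k \<in> A - {r}" for k
      using KcI[of "\<lambda>i. if i = k then 1 else 0" "\<lambda>_. 0"] delta[OF _ that, of 1 v] fin by simp
    moreover have "w k \<in> Kc" "- w k \<in> Kc" if "k \<in> B" for k
      using KcI[of "\<lambda>_. 0" "\<lambda>i. if i = k then 1 else 0"] KcI[of "\<lambda>_. 0" "\<lambda>i. if i = k then -1 else 0"]
        delta[OF fin(2) that, of 1 w] delta[OF fin(2) that, of "-1" w] by simp_all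
    ultimately show ?thesis unfolding T_def by blast
  qed
  ultimately have "convex_cone hull T \<subseteq> Kc" by (simp add: hull_minimal)
  moreover have "- v r \<notin> Kc" using r unfolding implicit_equalities_def Kc_def by blast
  ultimately have "- v r \<notin> convex_cone hull T" by blast
  then obtain q \<beta> where q: "q \<bullet> (- v r) < \<beta>" "\<And>x. x \<in> convex_cone hull T \<Longrightarrow> q \<bullet> x > \<beta>"
    using separating_hyperplane_closed_point[OF convex_convex_cone_hull closed_convex_cone_hull, of T "- v r"] fin
    unfolding T_def by auto
  have \<beta>: "\<beta> < 0" using q(2)[OF convex_cone_hull_contains_0] by simp
  have pos: "q \<bullet> x \<ge> 0" if "x \<in> convex_cone hull T" for x
  proof (rule ccontr)
    assume "\<not> q \<bullet> x \<ge> 0"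
    then have neg: "q \<bullet> x < 0" by simp
    have "q \<bullet> ((\<beta> / (q \<bullet> x)) *\<^sub>R x) > \<beta>"
      using convex_cone_hull_mul[OF that, of "\<beta> / (q \<bullet> x)"] neg \<beta>
      by (intro q(2)) (simp add: divide_nonpos_neg)
    then show False using neg by simp
  qed
  define s where "s = q \<bullet> v r"
  have s: "s > 0" using q(1) \<beta> by (simp add: s_def)
  define d where "d = - (1 / s) *\<^sub>R q"
  have T: "x \<bullet> d \<le> 0" if "x \<in> T" for x
    using pos[OF hull_inc[OF that]] s by (simp add: d_def inner_commute divide_nonneg_pos)
  show ?thesis
  proof
    show vr: "v r \<bullet> d = -1" using s by (simp add: d_def s_def inner_commute)
    show "v i \<bullet> d \<le> 0" if "i \<in> A" for i
      using T[of "v i"] that vr by (cases "i = r") (auto simp: T_def)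
    show "w j \<bullet> d = 0" if "j \<in> B" for j
      using T[of "w j"] T[of "- w j"] that by (auto simp: T_def)
  qed
qed

text \<open>
  The sum of the separating directions for all \<open>r \<in> A - J\<close> works: each summand is nonpositive on all
  of \<open>v\<close>. On \<open>J\<close> the products vanish because \<open>- v r\<close> is itself in the cone and so also
  has a nonpositive product with \<open>d\<close>.
\<close>

lemma descent_direction:
  fixes v :: "'i \<Rightarrow> 'a::euclidean_space"
  assumes fin: "finite A" "finite B"
  obtains d where "\<And>i. i \<in> A - implicit_equalities A B v w \<Longrightarrow> v i \<bullet> d \<le> -1"
    "\<And>i. i \<in> implicit_equalities A B v w \<Longrightarrow> v i \<bullet> d = 0" "\<And>j. j \<in> B \<Longrightarrow> w j \<bullet> d = 0"
proof -
  let ?J = "implicit_equalities A B v w"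
  have JA: "?J \<subseteq> A" by (auto simp: implicit_equalities_def)
  have "\<forall>r\<in>A - ?J. \<exists>d. v r \<bullet> d = -1 \<and> (\<forall>i\<in>A. v i \<bullet> d \<le> 0) \<and> (\<forall>j\<in>B. w j \<bullet> d = 0)"
  proof
    fix r assume "r \<in> A - ?J"
    then show "\<exists>d. v r \<bullet> d = -1 \<and> (\<forall>i\<in>A. v i \<bullet> d \<le> 0) \<and> (\<forall>j\<in>B. w j \<bullet> d = 0)"
      using separating_direction[OF fin, of r v w] by (metis DiffE)
  qed
  then obtain ds where ds: "\<And>r. r \<in> A - ?J \<Longrightarrow> v r \<bullet> ds r = -1"
     "\<And>r i. r \<in> A - ?J \<Longrightarrow> i \<in> A \<Longrightarrow> v i \<bullet> ds r \<le> 0" "\<And>r j. r \<in> A - ?J \<Longrightarrow> j \<in> B \<Longrightarrow> w j \<bullet> ds r = 0"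
    by metis
  define d where "d = (\<Sum>r\<in>A - ?J. ds r)"
  have le: "v i \<bullet> d \<le> 0" if "i \<in> A" for i
    using ds(2) that unfolding d_def inner_sum_right by (intro sum_nonpos) auto
  have eq: "w j \<bullet> d = 0" if "j \<in> B" for j
    using ds(3) that unfolding d_def inner_sum_right by (intro sum.neutral) auto
  show ?thesis
  proof
    show "w j \<bullet> d = 0" if "j \<in> B" for j using eq that .
    show "v i \<bullet> d \<le> -1" if i: "i \<in> A - ?J" for i
    proof -
      have "v i \<bullet> d = v i \<bullet> ds i + (\<Sum>r\<in>A - ?J - {i}. v i \<bullet> ds r)"
        unfolding d_def inner_sum_right using fin i by (intro sum.remove) auto
      also have "\<dots> \<le> -1 + 0"
        using i ds(1)[OF i] ds(2) by (intro add_mono sum_nonpos) auto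
      finally show ?thesis by simp
    qed
    show "v r \<bullet> d = 0" if r: "r \<in> ?J" for r
    proof -
      from r obtain \<kappa> \<rho> where k: "\<forall>i\<in>A - {r}. 0 \<le> \<kappa> i"
         "- v r = (\<Sum>i\<in>A - {r}. \<kappa> i *\<^sub>R v i) + (\<Sum>j\<in>B. \<rho> j *\<^sub>R w j)"
        unfolding implicit_equalities_def by blast
      have "- (v r \<bullet> d) = (\<Sum>i\<in>A - {r}. \<kappa> i * (v i \<bullet> d)) + (\<Sum>j\<in>B. \<rho> j * (w j \<bullet> d))"
        using arg_cong[OF k(2), of "\<lambda>x. x \<bullet> d"] by (simp add: inner_add_left inner_sum_left)
      also have "\<dots> \<le> 0 + 0"
        using k(1) le eq by (intro add_mono sum_nonpos) (auto simp: mult_nonneg_nonpos)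
      finally show ?thesis using le[of r] r JA by auto
    qed
  qed
qed

text \<open>
  Add up the relations that define membership of each \<open>r \<in> J\<close>; the \<open>r\<close>-th one contributes the
  coefficient \<open>1\<close> at \<open>r\<close>. No inequality outside \<open>J\<close> can occur with a positive coefficient, as one sees by
  taking the product with the descent direction.
\<close>

lemma positive_relation:
  fixes v :: "'i \<Rightarrow> 'a::euclidean_space"
  assumes fin: "finite A" "finite B"
  obtains \<kappa> \<rho> where "\<And>i. i \<in> implicit_equalities A B v w \<Longrightarrow> 1 \<le> \<kappa> i"
    "(\<Sum>i\<in>implicit_equalities A B v w. \<kappa> i *\<^sub>R v i) + (\<Sum>j\<in>B. \<rho> j *\<^sub>R w j) = 0"
proof -
  let ?J = "implicit_equalities A B v w"
  have JA: "?J \<subseteq> A" by (auto simp: implicit_equalities_def)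
  then have finJ: "finite ?J" using fin finite_subset by blast
  obtain d where d: "\<And>i. i \<in> A - ?J \<Longrightarrow> v i \<bullet> d \<le> -1"
    "\<And>i. i \<in> ?J \<Longrightarrow> v i \<bullet> d = 0" "\<And>j. j \<in> B \<Longrightarrow> w j \<bullet> d = 0"
    using descent_direction[OF fin, of v w] by blast
  have "\<exists>\<kappa> \<rho>. (\<forall>i\<in>?J. 0 \<le> \<kappa> i) \<and> \<kappa> r = 1 \<and> (\<Sum>i\<in>?J. \<kappa> i *\<^sub>R v i) + (\<Sum>j\<in>B. \<rho> j *\<^sub>R w j) = 0"
    if r: "r \<in> ?J" for r
  proof -
    from r obtain \<kappa> \<rho> where k: "\<forall>i\<in>A - {r}. 0 \<le> \<kappa> i"
       "- v r = (\<Sum>i\<in>A - {r}. \<kappa> i *\<^sub>R v i) + (\<Sum>j\<in>B. \<rho> j *\<^sub>R w j)"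
      unfolding implicit_equalities_def by blast
    define \<kappa>' where "\<kappa>' = \<kappa>(r := 1)"
    have nonneg: "\<forall>i\<in>A. 0 \<le> \<kappa>' i" using k(1) by (auto simp: \<kappa>'_def)
    have "(\<Sum>i\<in>A - {r}. \<kappa>' i *\<^sub>R v i) = (\<Sum>i\<in>A - {r}. \<kappa> i *\<^sub>R v i)"
      by (intro sum.cong) (auto simp: \<kappa>'_def)
    then have rel: "(\<Sum>i\<in>A. \<kappa>' i *\<^sub>R v i) + (\<Sum>j\<in>B. \<rho> j *\<^sub>R w j) = 0"
      using k(2) fin(1) r JA
      by (subst sum.remove[of A r]) (auto simp: \<kappa>'_def neg_eq_iff_add_eq_0 add.assoc)
    have supp: "\<kappa>' i = 0" if i: "i \<in> A - ?J" for i
    proof (rule ccontr)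
      assume "\<kappa>' i \<noteq> 0"
      then have pos: "\<kappa>' i > 0" using nonneg i by force
      have "(\<Sum>i\<in>A. \<kappa>' i * (v i \<bullet> d)) + (\<Sum>j\<in>B. \<rho> j * (w j \<bullet> d)) = 0"
        using arg_cong[OF rel, of "\<lambda>x. x \<bullet> d"] by (simp add: inner_add_left inner_sum_left)
      then have "(\<Sum>i\<in>A. \<kappa>' i * (v i \<bullet> d)) = 0" using d(3) by simp
      moreover have "(\<Sum>i\<in>A. \<kappa>' i * (v i \<bullet> d)) = \<kappa>' i * (v i \<bullet> d) + (\<Sum>k\<in>A - {i}. \<kappa>' k * (v k \<bullet> d))"
        using fin i by (intro sum.remove) auto
      moreover have "(\<Sum>k\<in>A - {i}. \<kappa>' k * (v k \<bullet> d)) \<le> 0"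
      proof (rule sum_nonpos)
        fix k assume "k \<in> A - {i}"
        then show "\<kappa>' k * (v k \<bullet> d) \<le> 0"
          using nonneg d(1)[of k] d(2)[of k] by (cases "k \<in> ?J") (auto simp: mult_nonneg_nonpos)
      qed
      moreover have "\<kappa>' i * (v i \<bullet> d) < 0"
        using pos d(1)[OF i] by (simp add: mult_pos_neg)
      ultimately show False by simp
    qed
    have "(\<Sum>i\<in>A. \<kappa>' i *\<^sub>R v i) = (\<Sum>i\<in>?J. \<kappa>' i *\<^sub>R v i)"
      using JA fin supp by (intro sum.mono_neutral_right) auto
    moreover have "\<kappa>' r = 1" by (simp add: \<kappa>'_def)
    moreover have "\<forall>i\<in>?J. 0 \<le> \<kappa>' i" using nonneg JA by blast
    ultimately show ?thesis using rel by metis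
  qed
  then obtain \<kappa> \<rho> where kr: "\<And>r i. r \<in> ?J \<Longrightarrow> i \<in> ?J \<Longrightarrow> 0 \<le> \<kappa> r i" "\<And>r. r \<in> ?J \<Longrightarrow> \<kappa> r r = 1"
      "\<And>r. r \<in> ?J \<Longrightarrow> (\<Sum>i\<in>?J. \<kappa> r i *\<^sub>R v i) + (\<Sum>j\<in>B. \<rho> r j *\<^sub>R w j) = 0"
    by metis
  show ?thesis
  proof
    show "1 \<le> (\<Sum>r\<in>?J. \<kappa> r i)" if "i \<in> ?J" for i
      using member_le_sum[of i ?J "\<lambda>r. \<kappa> r i"] that finJ kr(1,2) by simp
    have "(\<Sum>i\<in>?J. (\<Sum>r\<in>?J. \<kappa> r i) *\<^sub>R v i) = (\<Sum>r\<in>?J. \<Sum>i\<in>?J. \<kappa> r i *\<^sub>R v i)"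
      unfolding scaleR_sum_left by (rule sum.swap)
    moreover have "(\<Sum>j\<in>B. (\<Sum>r\<in>?J. \<rho> r j) *\<^sub>R w j) = (\<Sum>r\<in>?J. \<Sum>j\<in>B. \<rho> r j *\<^sub>R w j)"
      unfolding scaleR_sum_left by (rule sum.swap)
    ultimately show "(\<Sum>i\<in>?J. (\<Sum>r\<in>?J. \<kappa> r i) *\<^sub>R v i) + (\<Sum>j\<in>B. (\<Sum>r\<in>?J. \<rho> r j) *\<^sub>R w j) = 0"
      using kr(3) by (simp add: sum.distrib[symmetric])
  qed
qed

section \<open>Error bound under constant rank of the subspace component\<close>

text \<open>
  A system of active inequalities and equations at \<open>x0\<close> that satisfies the constant rank of the
  subspace component condition.
\<close>

locale constant_rank_system =
  fixes A :: "'i set" and B :: "'j set"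
    and g :: "'i \<Rightarrow> 'a::euclidean_space \<Rightarrow> real" and Dg :: "'i \<Rightarrow> 'a \<Rightarrow> 'a"
    and h :: "'j \<Rightarrow> 'a \<Rightarrow> real" and Dh :: "'j \<Rightarrow> 'a \<Rightarrow> 'a"
    and x0 :: 'a and J :: "'i set" and rk :: nat
  defines "J \<equiv> implicit_equalities A B (\<lambda>i. Dg i x0) (\<lambda>j. Dh j x0)"
  assumes finA: "finite A" and finB: "finite B"
    and der_g: "\<And>i x. i \<in> A \<Longrightarrow> GDERIV (g i) x :> Dg i x"
    and der_h: "\<And>j x. j \<in> B \<Longrightarrow> GDERIV (h j) x :> Dh j x"
    and cont_g: "\<And>i. i \<in> A \<Longrightarrow> continuous_on UNIV (Dg i)"
    and cont_h: "\<And>j. j \<in> B \<Longrightarrow> continuous_on UNIV (Dh j)"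
    and active: "\<And>i. i \<in> A \<Longrightarrow> g i x0 = 0"
    and solves: "\<And>j. j \<in> B \<Longrightarrow> h j x0 = 0"
    and constant_rank:
      "eventually (\<lambda>x. dim ((\<lambda>i. Dg i x) ` J \<union> (\<lambda>j. Dh j x) ` B) = rk) (nhds x0)"
begin

definition residual :: "'a \<Rightarrow> real" where
  "residual x = (\<Sum>i\<in>A. max (g i x) 0) + (\<Sum>j\<in>B. \<bar>h j x\<bar>)"

definition eq_residual :: "'a \<Rightarrow> real" where
  "eq_residual x = (\<Sum>i\<in>J. \<bar>g i x\<bar>) + (\<Sum>j\<in>B. \<bar>h j x\<bar>)"

definition solves_eqs :: "'a \<Rightarrow> bool" where
  "solves_eqs z \<longleftrightarrow> (\<forall>i\<in>J. g i z = 0) \<and> (\<forall>j\<in>B. h j z = 0)"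

lemma J_subset: "J \<subseteq> A"
  by (auto simp: J_def implicit_equalities_def)

lemma finJ: "finite J"
  using J_subset finA finite_subset by blast

lemma isCont_g: "i \<in> A \<Longrightarrow> isCont (g i) x"
  using der_g unfolding gderiv_def by (blast intro: has_derivative_continuous)

lemma isCont_h: "j \<in> B \<Longrightarrow> isCont (h j) x"
  using der_h unfolding gderiv_def by (blast intro: has_derivative_continuous)

lemma residual_nonneg: "residual x \<ge> 0"
  by (auto simp: residual_def intro!: add_nonneg_nonneg sum_nonneg)

lemma residual_tendsto: "(residual \<longlongrightarrow> 0) (nhds x0)"
proof -
  have "isCont residual x0"
    unfolding residual_def[abs_def] by (intro continuous_intros isCont_g isCont_h) auto
  moreover have "residual x0 = 0" by (simp add: residual_def active solves)
  ultimately show ?thesis using isCont_imp_tendsto_nhds by fastforce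
qed

lemma eq_residual_tendsto: "(eq_residual \<longlongrightarrow> 0) (nhds x0)"
proof -
  have "isCont eq_residual x0"
    unfolding eq_residual_def[abs_def] using J_subset
    by (intro continuous_intros isCont_g isCont_h) auto
  moreover have "eq_residual x0 = 0"
    using J_subset by (auto simp: eq_residual_def active solves intro!: sum.neutral)
  ultimately show ?thesis using isCont_imp_tendsto_nhds by fastforce
qed

lemma equality_retraction:
  obtains C where "C > 0"
    "eventually (\<lambda>x. \<exists>z. solves_eqs z \<and> dist x z \<le> C * eq_residual x) (nhds x0)"
proof -
  let ?F = "case_sum g h" and ?D = "case_sum Dg Dh"
  have im: "(\<lambda>k. ?D k x) ` (J <+> B) = (\<lambda>i. Dg i x) ` J \<union> (\<lambda>j. Dh j x) ` B" for x
    by (force simp: Plus_def)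
  have sums: "(\<Sum>k\<in>J <+> B. \<bar>?F k x\<bar>) = eq_residual x" for x
    by (simp add: sum.Plus finJ finB eq_residual_def)
  have all: "(\<forall>k\<in>J <+> B. ?F k z = 0) \<longleftrightarrow> solves_eqs z" for z
    by (force simp: solves_eqs_def)
  obtain C where "C > 0"
    "eventually (\<lambda>x. \<exists>z. (\<forall>k\<in>J <+> B. ?F k z = 0) \<and> dist x z \<le> C * (\<Sum>k\<in>J <+> B. \<bar>?F k x\<bar>)) (nhds x0)"
  proof (rule constant_rank_retraction[of "J <+> B" ?F ?D x0 rk])
    show "eventually (\<lambda>x. dim ((\<lambda>k. ?D k x) ` (J <+> B)) = rk) (nhds x0)"
      unfolding im by (rule constant_rank)
  qed (use finJ finB J_subset der_g der_h cont_g cont_h active solves in auto)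
  then show ?thesis using that unfolding sums all by blast
qed

text \<open>
  With \<open>\<bar>u\<bar> = 2 * max u 0 - u\<close>, the sum \<open>\<Sum>\<kappa>\<^sub>i \<bar>g\<^sub>i x\<bar>\<close> over \<open>J\<close> is twice its positive part minus
  \<open>L x\<close> plus a combination of the \<open>h\<^sub>j x\<close>. As \<open>L\<close> is flat at \<open>x0\<close> and vanishes at the retracted point,
  \<open>\<bar>L x\<bar>\<close> can be made at most half of the two-sided residual and absorbed on the left.
\<close>

lemma implicit_residual_bound:
  obtains C where "C > 0" "eventually (\<lambda>x. eq_residual x \<le> C * residual x) (nhds x0)"
proof -
  obtain C where C: "C > 0"
    "eventually (\<lambda>x. \<exists>z. solves_eqs z \<and> dist x z \<le> C * eq_residual x) (nhds x0)"
    by (rule equality_retraction)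
  obtain \<kappa> \<rho> where \<kappa>: "\<And>i. i \<in> J \<Longrightarrow> 1 \<le> \<kappa> i"
    and rel: "(\<Sum>i\<in>J. \<kappa> i *\<^sub>R Dg i x0) + (\<Sum>j\<in>B. \<rho> j *\<^sub>R Dh j x0) = 0"
    using positive_relation[OF finA finB, of "\<lambda>i. Dg i x0" "\<lambda>j. Dh j x0"] unfolding J_def by blast
  define L where "L x = (\<Sum>i\<in>J. \<kappa> i * g i x) + (\<Sum>j\<in>B. \<rho> j * h j x)" for x
  define DL where "DL x = (\<Sum>i\<in>J. \<kappa> i *\<^sub>R Dg i x) + (\<Sum>j\<in>B. \<rho> j *\<^sub>R Dh j x)" for x
  have der_L: "GDERIV L x :> DL x" for x
  proof -
    have "(L has_derivative (\<lambda>w. (\<Sum>i\<in>J. \<kappa> i * (w \<bullet> Dg i x)) + (\<Sum>j\<in>B. \<rho> j * (w \<bullet> Dh j x)))) (at x)"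
      unfolding L_def[abs_def] using der_g der_h J_subset unfolding gderiv_def
      by (intro has_derivative_add has_derivative_sum has_derivative_mult_right) auto
    then show ?thesis
      by (simp add: gderiv_def DL_def inner_add_right inner_sum_right)
  qed
  have cont_L: "continuous_on UNIV DL"
    unfolding DL_def[abs_def] using cont_g cont_h J_subset by (intro continuous_intros) auto
  \<comment> \<open>The slope \<open>1 / (2 * C)\<close> cancels the constant of the retraction and leaves the factor \<open>1/2\<close>.\<close>
  have "1 / (2 * C) > 0" using C(1) by simp
  from strict_differentiability[OF der_L cont_L this, of x0]
  obtain \<delta> where \<delta>: "\<delta> > 0"
    "\<And>x y. x \<in> ball x0 \<delta> \<Longrightarrow> y \<in> ball x0 \<delta> \<Longrightarrow> \<bar>L y - L x\<bar> \<le> 1 / (2 * C) * dist x y"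
    using rel by (auto simp: DL_def)
  define K where "K = (\<Sum>i\<in>J. \<kappa> i)"
  define R where "R = (\<Sum>j\<in>B. \<bar>\<rho> j\<bar>)"
  have K0: "K \<ge> 0" using \<kappa> unfolding K_def by (intro sum_nonneg) (metis order.trans zero_le_one)
  have R0: "R \<ge> 0" unfolding R_def by (intro sum_nonneg) auto
  have near: "eventually (\<lambda>x. x \<in> ball x0 \<delta>) (nhds x0)"
    using \<delta>(1) by (intro eventually_nhds_in_open) auto
  have "((\<lambda>x. C * eq_residual x) \<longlongrightarrow> 0) (nhds x0)"
    using tendsto_mult_right_zero[OF eq_residual_tendsto] by (simp add: mult.commute)
  from eventually_nearby[OF near this]
  have "eventually (\<lambda>x. eq_residual x \<le> (4 * K + 2 * R + 3) * residual x) (nhds x0)"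
    using C(2) near
  proof eventually_elim
    case (elim x)
    then obtain z where z: "solves_eqs z" "dist x z \<le> C * eq_residual x" "z \<in> ball x0 \<delta>"
      by blast
    have "L z = 0" using z(1) by (simp add: L_def solves_eqs_def)
    then have "\<bar>L x\<bar> \<le> 1 / (2 * C) * dist x z" using \<delta>(2)[OF elim(3) z(3)] by simp
    also have "\<dots> \<le> 1 / (2 * C) * (C * eq_residual x)"
      using z(2) C(1) by (intro mult_left_mono) auto
    also have "\<dots> = eq_residual x / 2" using C(1) by simp
    finally have L: "\<bar>L x\<bar> \<le> eq_residual x / 2" .
    define s where "s = (\<Sum>i\<in>J. \<bar>g i x\<bar>)"
    define t where "t = (\<Sum>j\<in>B. \<bar>h j x\<bar>)"
    have pos_part: "(\<Sum>i\<in>J. max (g i x) 0) \<le> residual x" and t_le: "t \<le> residual x"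
    proof -
      have "(\<Sum>i\<in>J. max (g i x) 0) \<le> (\<Sum>i\<in>A. max (g i x) 0)"
        using J_subset finA by (intro sum_mono2) auto
      moreover have "(\<Sum>i\<in>A. max (g i x) 0) \<ge> 0" "t \<ge> 0" by (auto simp: t_def intro!: sum_nonneg)
      ultimately show "(\<Sum>i\<in>J. max (g i x) 0) \<le> residual x" "t \<le> residual x"
        unfolding residual_def t_def by linarith+
    qed
    have "s \<le> (\<Sum>i\<in>J. \<kappa> i * \<bar>g i x\<bar>)"
      unfolding s_def using \<kappa> by (intro sum_mono) (simp add: mult_le_cancel_right1)
    also have "\<dots> = 2 * (\<Sum>i\<in>J. \<kappa> i * max (g i x) 0) - (\<Sum>i\<in>J. \<kappa> i * g i x)"
      unfolding sum_distrib_left sum_subtractf[symmetric]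
      by (intro sum.cong) (auto simp: max_def algebra_simps)
    also have "\<dots> = 2 * (\<Sum>i\<in>J. \<kappa> i * max (g i x) 0) - L x + (\<Sum>j\<in>B. \<rho> j * h j x)"
      by (simp add: L_def)
    finally have s1: "s \<le> 2 * (\<Sum>i\<in>J. \<kappa> i * max (g i x) 0) - L x + (\<Sum>j\<in>B. \<rho> j * h j x)" .
    have k1: "(\<Sum>i\<in>J. \<kappa> i * max (g i x) 0) \<le> K * residual x"
    proof -
      have "(\<Sum>i\<in>J. \<kappa> i * max (g i x) 0) \<le> (\<Sum>i\<in>J. K * max (g i x) 0)"
      proof (intro sum_mono mult_right_mono)
        fix i assume "i \<in> J"
        then show "\<kappa> i \<le> K"
          unfolding K_def using \<kappa> finJ by (intro member_le_sum) (auto intro: order.trans[OF zero_le_one])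
      qed auto
      also have "\<dots> \<le> K * residual x"
        unfolding sum_distrib_left[symmetric] using pos_part K0 by (rule mult_left_mono)
      finally show ?thesis .
    qed
    have "(\<Sum>j\<in>B. \<rho> j * h j x) \<le> (\<Sum>j\<in>B. \<bar>\<rho> j\<bar> * t)"
    proof (intro sum_mono)
      fix j assume j: "j \<in> B"
      have "\<bar>h j x\<bar> \<le> t" unfolding t_def using j finB by (intro member_le_sum) auto
      have "\<rho> j * h j x \<le> \<bar>\<rho> j\<bar> * \<bar>h j x\<bar>" by (metis abs_ge_self abs_mult)
      also have "\<dots> \<le> \<bar>\<rho> j\<bar> * t" using \<open>\<bar>h j x\<bar> \<le> t\<close> by (intro mult_left_mono) auto
      finally show "\<rho> j * h j x \<le> \<bar>\<rho> j\<bar> * t" .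
    qed
    also have "\<dots> = R * t" by (simp add: R_def sum_distrib_right)
    also have "\<dots> \<le> R * residual x" using t_le R0 by (rule mult_left_mono)
    finally have "(\<Sum>j\<in>B. \<rho> j * h j x) \<le> R * residual x" .
    moreover have "- L x \<le> (s + t) / 2" using L by (simp add: eq_residual_def s_def t_def)
    ultimately have "s + t \<le> 4 * (K * residual x) + 2 * (R * residual x) + 3 * residual x"
      using s1 k1 t_le residual_nonneg[of x] by (simp add: field_simps)
    then show ?case by (simp add: eq_residual_def s_def t_def algebra_simps)
  qed
  then show ?thesis using K0 R0 by (intro that[of "4 * K + 2 * R + 3"]) auto
qed

text \<open>
  From \<open>x\<close> retract to \<open>z1\<close>, step to \<open>z2 = z1 + \<tau> d\<close> and retract to \<open>z3\<close>. The step size \<open>\<tau>\<close> is a multiple of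
  the residual large enough that the decrease of the inequalities outside \<open>J\<close> outweighs their
  possible growth in the first retraction. The second retraction is negligible against \<open>\<tau>\<close>: the step
  is tangent to first order, so \<open>z2\<close> violates the equations only by a small multiple of \<open>\<tau>\<close>.
\<close>

lemma error_bound:
  obtains C where "C > 0"
    "eventually (\<lambda>x. \<exists>z. (\<forall>i\<in>A. g i z \<le> 0) \<and> (\<forall>j\<in>B. h j z = 0) \<and> dist x z \<le> C * residual x) (nhds x0)"
proof -
  obtain C0 where C0: "C0 > 0"
    "eventually (\<lambda>x. \<exists>z. solves_eqs z \<and> dist x z \<le> C0 * eq_residual x) (nhds x0)"
    by (rule equality_retraction)
  obtain C1 where C1: "C1 > 0" "eventually (\<lambda>x. eq_residual x \<le> C1 * residual x) (nhds x0)"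
    by (rule implicit_residual_bound)
  obtain d where d: "\<And>i. i \<in> A - J \<Longrightarrow> Dg i x0 \<bullet> d \<le> -1"
    "\<And>i. i \<in> J \<Longrightarrow> Dg i x0 \<bullet> d = 0" "\<And>j. j \<in> B \<Longrightarrow> Dh j x0 \<bullet> d = 0"
    using descent_direction[OF finA finB, of "\<lambda>i. Dg i x0" "\<lambda>j. Dh j x0"] unfolding J_def by blast
  define C2 where "C2 = C0 * C1"
  define G where "G = (\<Sum>i\<in>A. norm (Dg i x0))"
  define N where "N = real (card J) + real (card B)"
  have nn: "C2 \<ge> 0" "G \<ge> 0" "N \<ge> 0" using C0(1) C1(1) by (auto simp: C2_def G_def N_def sum_nonneg)
  \<comment> \<open>The second retraction moves by at most \<open>e * q * \<tau>\<close>, and \<open>e * E * \<tau>\<close> collects the resulting errors in the inequalities; \<open>e\<close> is chosen such that they use up at most half of the decrease \<open>\<tau>\<close>.\<close>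
  define q where "q = C0 * N * norm d"
  have q0: "q \<ge> 0" using C0(1) nn by (simp add: q_def)
  define E where "E = (G + 1) * q + norm d"
  have E0: "E \<ge> 0" using nn q0 by (simp add: E_def)
  define e where "e = 1 / (2 * (E + 1))"
  have e: "e > 0" "e \<le> 1" "e * E \<le> 1/2" using E0 by (auto simp: e_def field_simps)
  \<comment> \<open>With \<open>\<tau> = c * residual x\<close>, half of the decrease compensates the initial violation and the growth in the first retraction.\<close>
  define c where "c = 2 * (1 + (G + 1) * C2)"
  have c0: "c > 0" using nn by (simp add: c_def add_pos_nonneg)
  obtain \<delta>1 where \<delta>1: "\<delta>1 > 0" "\<And>i x y. i \<in> A \<Longrightarrow> x \<in> ball x0 \<delta>1 \<Longrightarrow> y \<in> ball x0 \<delta>1 \<Longrightarrow>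
      \<bar>g i y - g i x - (y - x) \<bullet> Dg i x0\<bar> \<le> e * dist x y"
    using uniform_strict_differentiability[where f = g and D = Dg and p = x0, OF finA der_g cont_g e(1)] by blast
  obtain \<delta>2 where \<delta>2: "\<delta>2 > 0" "\<And>j x y. j \<in> B \<Longrightarrow> x \<in> ball x0 \<delta>2 \<Longrightarrow> y \<in> ball x0 \<delta>2 \<Longrightarrow>
      \<bar>h j y - h j x - (y - x) \<bullet> Dh j x0\<bar> \<le> e * dist x y"
    using uniform_strict_differentiability[where f = h and D = Dh and p = x0, OF finB der_h cont_h e(1)] by blast
  define W where "W = ball x0 (min \<delta>1 \<delta>2)"
  have near: "eventually (\<lambda>x. x \<in> W) (nhds x0)"
    unfolding W_def using \<delta>1(1) \<delta>2(1) by (intro eventually_nhds_in_open) auto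
  define good where "good z \<longleftrightarrow> z \<in> W \<and> (\<exists>z'\<in>W. solves_eqs z' \<and> dist z z' \<le> C0 * eq_residual z)" for z
  have "((\<lambda>x. C0 * eq_residual x) \<longlongrightarrow> 0) (nhds x0)"
    using tendsto_mult_right_zero[OF eq_residual_tendsto] by (simp add: mult.commute)
  from eventually_nearby[OF near this] have "eventually good (nhds x0)"
    using C0(2) near by eventually_elim (auto simp: good_def)
  moreover have "((\<lambda>x. (C2 + c * norm d) * residual x) \<longlongrightarrow> 0) (nhds x0)"
    using tendsto_mult_right_zero[OF residual_tendsto] by (simp add: mult.commute)
  ultimately have "eventually (\<lambda>x. \<forall>z. dist x z \<le> (C2 + c * norm d) * residual x \<longrightarrow> good z) (nhds x0)"
    by (rule eventually_nearby)
  then have "eventually (\<lambda>x. \<exists>z. (\<forall>i\<in>A. g i z \<le> 0) \<and> (\<forall>j\<in>B. h j z = 0) \<and>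
      dist x z \<le> (C2 + c * norm d + c * (e * q) + 1) * residual x) (nhds x0)"
    using C0(2) C1(2) near
  proof eventually_elim
    case (elim x)
    let ?r = "residual x"
    have r0: "?r \<ge> 0" by (rule residual_nonneg)
    from elim(2) obtain z1 where z1: "solves_eqs z1" "dist x z1 \<le> C0 * eq_residual x" by blast
    have "C0 * eq_residual x \<le> C0 * (C1 * ?r)" using elim(3) C0(1) by (intro mult_left_mono) auto
    with z1(2) have xz1: "dist x z1 \<le> C2 * ?r" by (simp add: C2_def mult.assoc)
    define \<tau> where "\<tau> = c * ?r"
    have \<tau>0: "\<tau> \<ge> 0" using c0 r0 by (simp add: \<tau>_def)
    define z2 where "z2 = z1 + \<tau> *\<^sub>R d"
    have z12: "dist z1 z2 = \<tau> * norm d" using \<tau>0 by (simp add: z2_def dist_norm)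
    have xz2: "dist x z2 \<le> C2 * ?r + \<tau> * norm d"
      using dist_triangle[of x z2 z1] xz1 z12 by simp
    have "good z1"
    proof -
      have "dist x z1 \<le> (C2 + c * norm d) * ?r"
        using xz1 c0 r0 by (simp add: distrib_right add_increasing2)
      then show ?thesis using elim(1) by blast
    qed
    then have z1W: "z1 \<in> W" by (simp add: good_def)
    have "good z2"
    proof -
      have "dist x z2 \<le> (C2 + c * norm d) * ?r"
        using xz2 by (simp add: \<tau>_def algebra_simps)
      then show ?thesis using elim(1) by blast
    qed
    then obtain z3 where z2W: "z2 \<in> W" and z3: "z3 \<in> W" "solves_eqs z3" "dist z2 z3 \<le> C0 * eq_residual z2"
      by (auto simp: good_def)
    have "eq_residual z2 \<le> (\<Sum>i\<in>J. e * (\<tau> * norm d)) + (\<Sum>j\<in>B. e * (\<tau> * norm d))"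
      unfolding eq_residual_def
    proof (intro add_mono sum_mono)
      fix i assume i: "i \<in> J"
      have "g i z1 = 0" using z1(1) i by (simp add: solves_eqs_def)
      moreover have "(z2 - z1) \<bullet> Dg i x0 = 0" using d(2)[OF i] by (simp add: z2_def inner_commute)
      ultimately show "\<bar>g i z2\<bar> \<le> e * (\<tau> * norm d)"
        using \<delta>1(2)[of i z1 z2] i J_subset z1W z2W z12 by (auto simp: W_def)
    next
      fix j assume j: "j \<in> B"
      have "h j z1 = 0" using z1(1) j by (simp add: solves_eqs_def)
      moreover have "(z2 - z1) \<bullet> Dh j x0 = 0" using d(3)[OF j] by (simp add: z2_def inner_commute)
      ultimately show "\<bar>h j z2\<bar> \<le> e * (\<tau> * norm d)"
        using \<delta>2(2)[of j z1 z2] j z1W z2W z12 by (auto simp: W_def)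
    qed
    also have "\<dots> = N * (e * (\<tau> * norm d))" by (simp add: N_def algebra_simps)
    finally have "C0 * eq_residual z2 \<le> C0 * (N * (e * (\<tau> * norm d)))"
      using C0(1) by (intro mult_left_mono) auto
    with z3(3) have z23: "dist z2 z3 \<le> e * q * \<tau>" by (simp add: q_def mult_ac)
    have xz3: "dist x z3 \<le> C2 * ?r + \<tau> * norm d + e * q * \<tau>"
      using dist_triangle[of x z3 z2] xz2 z23 by simp
    have "g i z3 \<le> 0" if i: "i \<in> A - J" for i
    proof -
      have Gi: "norm (Dg i x0) \<le> G"
        unfolding G_def using i finA by (intro member_le_sum) auto
      have cs: "(u - v) \<bullet> Dg i x0 \<le> dist v u * G" for u v
      proof -
        have "(u - v) \<bullet> Dg i x0 \<le> norm (u - v) * norm (Dg i x0)" by (rule norm_cauchy_schwarz)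
        also have "\<dots> \<le> dist v u * G" using Gi by (simp add: dist_norm norm_minus_commute mult_left_mono)
        finally show ?thesis .
      qed
      have gx: "g i x \<le> ?r"
      proof -
        have "max (g i x) 0 \<le> (\<Sum>i\<in>A. max (g i x) 0)" using i finA by (intro member_le_sum) auto
        moreover have "(\<Sum>j\<in>B. \<bar>h j x\<bar>) \<ge> 0" by (auto intro: sum_nonneg)
        moreover have "g i x \<le> max (g i x) 0" by simp
        ultimately show ?thesis unfolding residual_def by linarith
      qed
      have "(z3 - x) \<bullet> Dg i x0 = (z1 - x) \<bullet> Dg i x0 + \<tau> * (Dg i x0 \<bullet> d) + (z3 - z2) \<bullet> Dg i x0"
        by (simp add: z2_def inner_simps inner_commute)
      also have "\<dots> \<le> dist x z1 * G + \<tau> * (-1) + dist z2 z3 * G"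
        using d(1)[OF i] \<tau>0 by (intro add_mono cs mult_left_mono)
      also have "\<dots> \<le> C2 * ?r * G - \<tau> + e * q * \<tau> * G"
        using mult_right_mono[OF xz1 nn(2)] mult_right_mono[OF z23 nn(2)] by simp
      finally have lin: "(z3 - x) \<bullet> Dg i x0 \<le> C2 * ?r * G - \<tau> + e * q * \<tau> * G" .
      have quad: "e * dist x z3 \<le> C2 * ?r + e * norm d * \<tau> + e * q * \<tau>"
      proof -
        have "e * dist x z3 \<le> e * (C2 * ?r) + e * (norm d * \<tau>) + e * (e * q * \<tau>)"
          using mult_left_mono[OF xz3, of e] e(1) by (simp add: algebra_simps)
        also have "\<dots> \<le> 1 * (C2 * ?r) + e * (norm d * \<tau>) + 1 * (e * q * \<tau>)"
          using e nn r0 q0 \<tau>0 by (intro add_mono mult_right_mono order_refl) auto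
        finally show ?thesis by (simp add: mult.assoc)
      qed
      have "g i z3 \<le> g i x + (z3 - x) \<bullet> Dg i x0 + e * dist x z3"
        using \<delta>1(2)[of i x z3] i elim(4) z3(1) by (auto simp: W_def)
      also have "\<dots> \<le> ?r + (C2 * ?r * G - \<tau> + e * q * \<tau> * G) + (C2 * ?r + e * norm d * \<tau> + e * q * \<tau>)"
        using gx lin quad by (intro add_mono)
      also have "\<dots> = (1 + (G + 1) * C2) * ?r - \<tau> + (e * E) * \<tau>"
        by (simp add: E_def algebra_simps)
      also have "\<dots> \<le> (1 + (G + 1) * C2) * ?r - \<tau> + 1/2 * \<tau>"
        using e(3) \<tau>0 by (intro add_left_mono mult_right_mono)
      also have "\<dots> = 0" by (simp add: \<tau>_def c_def algebra_simps)
      finally show ?thesis .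
    qed
    moreover have "\<forall>i\<in>J. g i z3 = 0" "\<forall>j\<in>B. h j z3 = 0" using z3(2) by (auto simp: solves_eqs_def)
    moreover have "dist x z3 \<le> (C2 + c * norm d + c * (e * q) + 1) * ?r"
      using xz3 r0 by (simp add: \<tau>_def algebra_simps)
    ultimately show ?case by (intro exI[of _ z3]) force
  qed
  moreover have "C2 + c * norm d + c * (e * q) + 1 > 0"
    using nn c0 e q0 by (intro add_nonneg_pos add_nonneg_nonneg) auto
  ultimately show ?thesis using that by blast
qed

end

section \<open>The branches of a program with switching constraints\<close>

lemma twice_continuously_differentiable_grad:
  assumes "twice_continuously_differentiable f"
  shows "GDERIV f x :> grad f x" "continuous_on UNIV (grad f)"
proof -
  from assms obtain D B where D: "\<And>x. GDERIV f x :> D x"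
    and B: "\<And>x. (D has_derivative (\<lambda>v. B x *v v)) (at x)"
    unfolding twice_continuously_differentiable_def by blast
  have uniq: "D' = D x" if "GDERIV f x :> D'" for D' x
    using has_derivative_unique[OF that[unfolded gderiv_def] D[of x, unfolded gderiv_def]]
    by (metis vector_eq_ldot)
  have eq: "grad f = D"
    unfolding grad_def[abs_def] using D uniq by (blast intro: the_equality)
  show "GDERIV f x :> grad f x" using D eq by simp
  show "continuous_on UNIV (grad f)"
    unfolding eq using B by (blast intro: continuous_at_imp_continuous_on has_derivative_continuous)
qed

text \<open>
  The equations of the branch given by a partition, collected in one family over a disjoint sum so
  that the results on general systems apply: equality constraints, then \<open>G\<close>, then \<open>H\<close>.
\<close>

definition piece_index :: "'n::finite mpsc \<Rightarrow> real^'n \<Rightarrow> nat set \<Rightarrow> nat set \<Rightarrow> (nat + nat + nat) set" where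
  "piece_index P xb \<beta>1 \<beta>2 = Ih P <+> ((IG P xb \<union> \<beta>1) <+> (IH P xb \<union> \<beta>2))"

definition piece_equ :: "'n::finite mpsc \<Rightarrow> nat + nat + nat \<Rightarrow> real^'n \<Rightarrow> real" where
  "piece_equ P = case_sum (equ P) (case_sum (swG P) (swH P))"

definition piece_residual ::
  "'n::finite mpsc \<Rightarrow> real^'n \<Rightarrow> nat set \<Rightarrow> nat set \<Rightarrow> real^'n \<Rightarrow> real" where
  "piece_residual P xb \<beta>1 \<beta>2 x =
     (\<Sum>i\<in>Ig P xb. max (ineq P i x) 0) + (\<Sum>k\<in>piece_index P xb \<beta>1 \<beta>2. \<bar>piece_equ P k x\<bar>)"

lemma bipartition_subset:
  assumes "(\<beta>1, \<beta>2) \<in> bipartitions (IGH P xb)"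
  shows "\<beta>1 \<subseteq> IGH P xb" "\<beta>2 \<subseteq> IGH P xb" "\<beta>1 \<union> \<beta>2 = IGH P xb"
  using assms by (auto simp: bipartitions_def)

lemma piece_index_cases:
  assumes "(\<beta>1, \<beta>2) \<in> bipartitions (IGH P xb)" and "k \<in> piece_index P xb \<beta>1 \<beta>2"
  obtains (equ) j where "k = Inl j" "j \<in> {1..num_eq P}"
  | (G) j where "k = Inr (Inl j)" "j \<in> {1..num_switch P}" "j \<in> IG P xb \<union> \<beta>1" "swG P j xb = 0"
  | (H) j where "k = Inr (Inr j)" "j \<in> {1..num_switch P}" "j \<in> IH P xb \<union> \<beta>2" "swH P j xb = 0"
  using assms(2) bipartition_subset[OF assms(1)]
  unfolding piece_index_def Ih_def IG_def IH_def IGH_def by blast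

lemma mem_piece_index:
  "Inl j \<in> piece_index P xb \<beta>1 \<beta>2 \<longleftrightarrow> j \<in> {1..num_eq P}"
  "Inr (Inl k) \<in> piece_index P xb \<beta>1 \<beta>2 \<longleftrightarrow> k \<in> IG P xb \<union> \<beta>1"
  "Inr (Inr k) \<in> piece_index P xb \<beta>1 \<beta>2 \<longleftrightarrow> k \<in> IH P xb \<union> \<beta>2"
  by (auto simp: piece_index_def Plus_def Ih_def)

lemma finite_index_sets:
  "finite (Ig P xb)" "finite (Ih P)" "finite (IG P xb)" "finite (IH P xb)" "finite (IGH P xb)"
  by (auto simp: Ig_def Ih_def IG_def IH_def IGH_def)

lemma finite_piece_index:
  assumes "(\<beta>1, \<beta>2) \<in> bipartitions (IGH P xb)"
  shows "finite (IG P xb \<union> \<beta>1)" "finite (IH P xb \<union> \<beta>2)" "finite (piece_index P xb \<beta>1 \<beta>2)"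
proof -
  have "finite \<beta>1" "finite \<beta>2"
    using bipartition_subset[OF assms] finite_index_sets(5) finite_subset by blast+
  then show "finite (IG P xb \<union> \<beta>1)" "finite (IH P xb \<union> \<beta>2)" "finite (piece_index P xb \<beta>1 \<beta>2)"
    by (simp_all add: piece_index_def finite_index_sets)
qed

lemma piece_smooth:
  assumes "smooth_data P" and "(\<beta>1, \<beta>2) \<in> bipartitions (IGH P xb)" and "k \<in> piece_index P xb \<beta>1 \<beta>2"
  shows "twice_continuously_differentiable (piece_equ P k)"
  using assms(2,3)
proof (cases rule: piece_index_cases)
qed (use assms(1) in \<open>auto simp: smooth_data_def piece_equ_def\<close>)

lemma piece_equ_zero:
  assumes "xb \<in> feasible P" and "(\<beta>1, \<beta>2) \<in> bipartitions (IGH P xb)" and "k \<in> piece_index P xb \<beta>1 \<beta>2"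
  shows "piece_equ P k xb = 0"
  using assms(2,3)
proof (cases rule: piece_index_cases)
qed (use assms(1) in \<open>auto simp: feasible_def piece_equ_def\<close>)

text \<open>
  Three families of free multipliers are the same as one family on the disjoint sum.
\<close>

lemma Ig_minus_eq_implicit_equalities:
  assumes "(\<beta>1, \<beta>2) \<in> bipartitions (IGH P xb)"
  shows "Ig_minus P xb \<beta>1 \<beta>2 =
    implicit_equalities (Ig P xb) (piece_index P xb \<beta>1 \<beta>2)
      (\<lambda>i. grad (ineq P i) xb) (\<lambda>k. grad (piece_equ P k) xb)"
proof -
  have fin: "finite (Ih P)" "finite (IG P xb \<union> \<beta>1)" "finite (IH P xb \<union> \<beta>2)"
    using finite_piece_index[OF assms] finite_index_sets by auto
  have sum_eq: "(\<Sum>k\<in>piece_index P xb \<beta>1 \<beta>2. \<sigma> k *\<^sub>R grad (piece_equ P k) xb) =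
      (\<Sum>j\<in>Ih P. \<sigma> (Inl j) *\<^sub>R grad (equ P j) xb) +
      ((\<Sum>k\<in>IG P xb \<union> \<beta>1. \<sigma> (Inr (Inl k)) *\<^sub>R grad (swG P k) xb) +
       (\<Sum>k\<in>IH P xb \<union> \<beta>2. \<sigma> (Inr (Inr k)) *\<^sub>R grad (swH P k) xb))" for \<sigma>
    unfolding piece_index_def piece_equ_def using fin by (simp add: sum.Plus)
  have ex_sum: "(\<exists>\<sigma> :: nat + nat + nat \<Rightarrow> real. Q (\<lambda>j. \<sigma> (Inl j)) (\<lambda>k. \<sigma> (Inr (Inl k))) (\<lambda>k. \<sigma> (Inr (Inr k)))) \<longleftrightarrow>
      (\<exists>\<rho> \<mu> \<nu>. Q \<rho> \<mu> \<nu>)" for Q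
  proof
    assume "\<exists>\<rho> \<mu> \<nu>. Q \<rho> \<mu> \<nu>"
    then obtain \<rho> \<mu> \<nu> where "Q \<rho> \<mu> \<nu>" by blast
    then show "\<exists>\<sigma> :: nat + nat + nat \<Rightarrow> real. Q (\<lambda>j. \<sigma> (Inl j)) (\<lambda>k. \<sigma> (Inr (Inl k))) (\<lambda>k. \<sigma> (Inr (Inr k)))"
      by (intro exI[of _ "case_sum \<rho> (case_sum \<mu> \<nu>)"]) simp
  qed blast
  show ?thesis
    unfolding Ig_minus_def implicit_equalities_def sum_eq
    using ex_sum[of "\<lambda>\<rho> \<mu> \<nu>. (\<forall>i \<in> Ig P xb - {r}. \<kappa> i \<ge> 0) \<and>
        - grad (ineq P r) xb =
            (\<Sum>i \<in> Ig P xb - {r}. \<kappa> i *\<^sub>R grad (ineq P i) xb) +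
            ((\<Sum>j \<in> Ih P. \<rho> j *\<^sub>R grad (equ P j) xb) +
            ((\<Sum>k \<in> IG P xb \<union> \<beta>1. \<mu> k *\<^sub>R grad (swG P k) xb) +
            (\<Sum>k \<in> IH P xb \<union> \<beta>2. \<nu> k *\<^sub>R grad (swH P k) xb)))" for r \<kappa>]
    by (simp only: add.assoc)
qed

lemma pcrsc_gradients_eq:
  "pcrsc_gradients P xb \<beta>1 \<beta>2 x =
     (\<lambda>i. grad (ineq P i) x) ` Ig_minus P xb \<beta>1 \<beta>2 \<union>
     (\<lambda>k. grad (piece_equ P k) x) ` piece_index P xb \<beta>1 \<beta>2"
  unfolding pcrsc_gradients_def piece_index_def piece_equ_def Plus_def
  by (simp add: image_Un image_image Un_assoc)

text \<open>
  Each switching index belongs to \<open>IG \<union> \<beta>1\<close> or \<open>IH \<union> \<beta>2\<close>, so one of the two factors of its product is forced to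
  vanish: every branch lies in the feasible set.
\<close>

lemma piece_feasible:
  assumes part: "(\<beta>1, \<beta>2) \<in> bipartitions (IGH P xb)"
    and "xb \<in> feasible P"
    and ineqs: "\<And>i. i \<in> {1..num_ineq P} \<Longrightarrow> ineq P i z \<le> 0"
    and eqs: "\<And>k. k \<in> piece_index P xb \<beta>1 \<beta>2 \<Longrightarrow> piece_equ P k z = 0"
  shows "z \<in> feasible P"
proof -
  have "equ P j z = 0" if "j \<in> {1..num_eq P}" for j
    using eqs[of "Inl j"] that by (simp add: mem_piece_index piece_equ_def)
  moreover have "swG P k z * swH P k z = 0" if k: "k \<in> {1..num_switch P}" for k
  proof -
    have "swG P k xb * swH P k xb = 0" using assms(2) k by (simp add: feasible_def)
    then have "k \<in> (IG P xb \<union> \<beta>1) \<union> (IH P xb \<union> \<beta>2)"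
      using k bipartition_subset(3)[OF part] by (auto simp: IG_def IH_def IGH_def)
    then show ?thesis
      using eqs[of "Inr (Inl k)"] eqs[of "Inr (Inr k)"]
      by (auto simp: mem_piece_index piece_equ_def)
  qed
  ultimately show ?thesis using ineqs by (auto simp: feasible_def)
qed

text \<open>
  The general error bound produces a point of the branch that respects the active inequalities;
  the inactive ones hold there by continuity, because the point is close to \<open>xb\<close>.
\<close>

lemma piece_error_bound:
  assumes smooth: "smooth_data P" and feas: "xb \<in> feasible P"
    and part: "(\<beta>1, \<beta>2) \<in> bipartitions (IGH P xb)"
    and "\<epsilon> > 0" and const: "(\<lambda>x. dim (pcrsc_gradients P xb \<beta>1 \<beta>2 x)) constant_on {x. norm (x - xb) < \<epsilon>}"
  obtains C where "C > 0"
    "eventually (\<lambda>x. infdist x (feasible P) \<le> C * piece_residual P xb \<beta>1 \<beta>2 x) (nhds xb)"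
proof -
  obtain rk where rk: "\<And>x. norm (x - xb) < \<epsilon> \<Longrightarrow> dim (pcrsc_gradients P xb \<beta>1 \<beta>2 x) = rk"
    using const unfolding constant_on_def by blast
  have tcd: "twice_continuously_differentiable (ineq P i)" if "i \<in> {1..num_ineq P}" for i
    using smooth that by (simp add: smooth_data_def)
  interpret constant_rank_system "Ig P xb" "piece_index P xb \<beta>1 \<beta>2"
    "ineq P" "\<lambda>i. grad (ineq P i)" "piece_equ P" "\<lambda>k. grad (piece_equ P k)" xb
    "Ig_minus P xb \<beta>1 \<beta>2" rk
  proof (unfold_locales, goal_cases)
    case 1 then show ?case by (simp add: finite_index_sets)
  next
    case 2 then show ?case by (rule finite_piece_index(3)[OF part])
  next
    case 3 then show ?case by (auto simp: Ig_def intro!: twice_continuously_differentiable_grad tcd)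
  next
    case 4 then show ?case by (intro twice_continuously_differentiable_grad piece_smooth[OF smooth part])
  next
    case 5 then show ?case by (auto simp: Ig_def intro!: twice_continuously_differentiable_grad tcd)
  next
    case 6 then show ?case by (intro twice_continuously_differentiable_grad piece_smooth[OF smooth part])
  next
    case 7 then show ?case by (simp add: Ig_def)
  next
    case 8 then show ?case by (rule piece_equ_zero[OF feas part])
  next
    case 9
    have "\<forall>x. dist x xb < \<epsilon> \<longrightarrow> dim ((\<lambda>i. grad (ineq P i) x) ` Ig_minus P xb \<beta>1 \<beta>2 \<union>
        (\<lambda>k. grad (piece_equ P k) x) ` piece_index P xb \<beta>1 \<beta>2) = rk"
      unfolding pcrsc_gradients_eq[symmetric] dist_norm by (intro allI impI rk)
    with \<open>\<epsilon> > 0\<close> show ?case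
      unfolding eventually_nhds_metric Ig_minus_eq_implicit_equalities[OF part, symmetric]
      by (intro exI[of _ \<epsilon>] conjI)
  next
    case 10 show "PROP ?case" by (rule eq_reflection[OF Ig_minus_eq_implicit_equalities[OF part]])
  qed
  obtain C where C: "C > 0"
    "eventually (\<lambda>x. \<exists>z. (\<forall>i\<in>Ig P xb. ineq P i z \<le> 0) \<and>
       (\<forall>k\<in>piece_index P xb \<beta>1 \<beta>2. piece_equ P k z = 0) \<and> dist x z \<le> C * residual x) (nhds xb)"
    by (rule error_bound)
  have "eventually (\<lambda>z. ineq P i z \<le> 0) (nhds xb)" if i: "i \<in> {1..num_ineq P} - Ig P xb" for i
  proof -
    have "isCont (ineq P i) xb"
      using twice_continuously_differentiable_grad(1)[OF tcd] i
      unfolding gderiv_def by (blast intro: has_derivative_continuous)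
    then have lim: "(ineq P i \<longlongrightarrow> ineq P i xb) (nhds xb)" by (rule isCont_imp_tendsto_nhds)
    have "ineq P i xb \<le> 0" "ineq P i xb \<noteq> 0" using feas i by (auto simp: feasible_def Ig_def)
    then have "ineq P i xb < 0" by simp
    from order_tendstoD(2)[OF lim this] show ?thesis by eventually_elim simp
  qed
  then have "eventually (\<lambda>z. \<forall>i\<in>{1..num_ineq P} - Ig P xb. ineq P i z \<le> 0) (nhds xb)"
    by (intro eventually_ball_finite) auto
  moreover have "((\<lambda>x. C * residual x) \<longlongrightarrow> 0) (nhds xb)"
    using tendsto_mult_right_zero[OF residual_tendsto] by (simp add: mult.commute)
  ultimately have "eventually (\<lambda>x. \<forall>z. dist x z \<le> C * residual x \<longrightarrow>
      (\<forall>i\<in>{1..num_ineq P} - Ig P xb. ineq P i z \<le> 0)) (nhds xb)"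
    by (rule eventually_nearby)
  then have "eventually (\<lambda>x. infdist x (feasible P) \<le> C * residual x) (nhds xb)"
    using C(2)
  proof eventually_elim
    case (elim x)
    then obtain z where z: "\<forall>i\<in>Ig P xb. ineq P i z \<le> 0"
      "\<forall>k\<in>piece_index P xb \<beta>1 \<beta>2. piece_equ P k z = 0" "dist x z \<le> C * residual x"
      "\<forall>i\<in>{1..num_ineq P} - Ig P xb. ineq P i z \<le> 0" by blast
    have "z \<in> feasible P" using z by (intro piece_feasible[OF part feas]) auto
    then show ?case using infdist_le[of z "feasible P" x] z(3) by linarith
  qed
  then show ?thesis using that C(1) unfolding residual_def piece_residual_def by blast
qed

text \<open>
  When the branch imposes the smaller of \<open>\<bar>G\<^sub>k x\<bar>\<close> and \<open>\<bar>H\<^sub>k x\<bar>\<close>, each of its terms is the square root of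
  a summand of the violation in the error bound.
\<close>

lemma piece_residual_le:
  assumes part: "(\<beta>1, \<beta>2) \<in> bipartitions (IGH P xb)"
    and G: "\<And>k. k \<in> IG P xb \<union> \<beta>1 \<Longrightarrow> \<bar>swG P k x\<bar> \<le> \<bar>swH P k x\<bar>"
    and H: "\<And>k. k \<in> IH P xb \<union> \<beta>2 \<Longrightarrow> \<bar>swH P k x\<bar> \<le> \<bar>swG P k x\<bar>"
  shows "piece_residual P xb \<beta>1 \<beta>2 x \<le> (card (Ig P xb) + card (piece_index P xb \<beta>1 \<beta>2)) * sqrt (
          (\<Sum>i\<in>{1..num_ineq P}. (max (ineq P i x) 0)\<^sup>2) +
          (\<Sum>j\<in>{1..num_eq P}. (equ P j x)\<^sup>2) +
          (\<Sum>k\<in>{1..num_switch P}. min ((swG P k x)\<^sup>2) ((swH P k x)\<^sup>2)))"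
proof -
  define s1 where "s1 = (\<Sum>i\<in>{1..num_ineq P}. (max (ineq P i x) 0)\<^sup>2)"
  define s2 where "s2 = (\<Sum>j\<in>{1..num_eq P}. (equ P j x)\<^sup>2)"
  define s3 where "s3 = (\<Sum>k\<in>{1..num_switch P}. min ((swG P k x)\<^sup>2) ((swH P k x)\<^sup>2))"
  have nn: "s1 \<ge> 0" "s2 \<ge> 0" "s3 \<ge> 0"
    unfolding s1_def s2_def s3_def by (auto intro!: sum_nonneg)
  have le1: "max (ineq P i x) 0 \<le> sqrt (s1 + s2 + s3)" if "i \<in> Ig P xb" for i
  proof (rule real_le_rsqrt)
    have "(max (ineq P i x) 0)\<^sup>2 \<le> s1"
      unfolding s1_def using that by (intro member_le_sum) (auto simp: Ig_def)
    then show "(max (ineq P i x) 0)\<^sup>2 \<le> s1 + s2 + s3" using nn by linarith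
  qed
  have le2: "\<bar>piece_equ P k x\<bar> \<le> sqrt (s1 + s2 + s3)" if k: "k \<in> piece_index P xb \<beta>1 \<beta>2" for k
  proof (rule real_le_rsqrt)
    have switch: "min ((swG P j x)\<^sup>2) ((swH P j x)\<^sup>2) \<le> s3" if "j \<in> {1..num_switch P}" for j
      unfolding s3_def using that by (intro member_le_sum) auto
    have "(piece_equ P k x)\<^sup>2 \<le> s2 \<or> (piece_equ P k x)\<^sup>2 \<le> s3"
      using part k
    proof (cases rule: piece_index_cases)
      case (equ j)
      then show ?thesis unfolding s2_def
        by (intro disjI1) (auto simp: piece_equ_def intro!: member_le_sum)
    next
      case (G j)
      then have "min ((swG P j x)\<^sup>2) ((swH P j x)\<^sup>2) = (swG P j x)\<^sup>2"
        using assms(2)[OF G(3)] by (simp add: min_def abs_le_square_iff)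
      then show ?thesis using switch[OF G(2)] G(1) by (simp add: piece_equ_def)
    next
      case (H j)
      then have "min ((swG P j x)\<^sup>2) ((swH P j x)\<^sup>2) = (swH P j x)\<^sup>2"
        using assms(3)[OF H(3)] by (simp add: min_def abs_le_square_iff)
      then show ?thesis using switch[OF H(2)] H(1) by (simp add: piece_equ_def)
    qed
    then show "\<bar>piece_equ P k x\<bar>\<^sup>2 \<le> s1 + s2 + s3" using nn by (auto simp: power2_abs)
  qed
  have "piece_residual P xb \<beta>1 \<beta>2 x \<le>
      (\<Sum>i\<in>Ig P xb. sqrt (s1 + s2 + s3)) + (\<Sum>k\<in>piece_index P xb \<beta>1 \<beta>2. sqrt (s1 + s2 + s3))"
    unfolding piece_residual_def using le1 le2 by (intro add_mono sum_mono)
  then show ?thesis unfolding s1_def s2_def s3_def by (simp add: algebra_simps)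
qed

lemma eventually_abs_less:
  fixes f g :: "'a::t2_space \<Rightarrow> real"
  assumes "isCont f x0" "isCont g x0" "\<bar>f x0\<bar> < \<bar>g x0\<bar>"
  shows "eventually (\<lambda>x. \<bar>f x\<bar> < \<bar>g x\<bar>) (nhds x0)"
proof -
  have "isCont (\<lambda>x. \<bar>g x\<bar> - \<bar>f x\<bar>) x0" using assms by (intro continuous_intros)
  from order_tendstoD(1)[OF isCont_imp_tendsto_nhds[OF this], of 0] show ?thesis
    using assms(3) by simp
qed

theorem theorem6p3:
  fixes P :: "'n::finite mpsc" and xb :: "real^'n"
  assumes "smooth_data P"
    and "xb \<in> feasible P"
    and "MPSC_PCRSC P xb"
  shows "local_error_bound P xb"
proof -
  let ?R = "\<lambda>x. sqrt ((\<Sum>i\<in>{1..num_ineq P}. (max (ineq P i x) 0)\<^sup>2) +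
          (\<Sum>j\<in>{1..num_eq P}. (equ P j x)\<^sup>2) +
          (\<Sum>k\<in>{1..num_switch P}. min ((swG P k x)\<^sup>2) ((swH P k x)\<^sup>2)))"
  let ?parts = "bipartitions (IGH P xb)"
  have finite_parts: "finite ?parts"
    by (rule finite_subset[of _ "Pow (IGH P xb) \<times> Pow (IGH P xb)"])
       (auto simp: bipartitions_def finite_index_sets)
  have "\<exists>C>0. eventually (\<lambda>x. infdist x (feasible P) \<le> C * piece_residual P xb (fst p) (snd p) x) (nhds xb)"
    if p: "p \<in> ?parts" for p
  proof -
    from p assms(3) obtain \<epsilon> where "\<epsilon> > 0"
      "(\<lambda>x. dim (pcrsc_gradients P xb (fst p) (snd p) x)) constant_on {x. norm (x - xb) < \<epsilon>}"
      unfolding MPSC_PCRSC_def by fastforce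
    then show ?thesis
      using piece_error_bound[OF assms(1,2), of "fst p" "snd p" \<epsilon>] p by (metis prod.collapse)
  qed
  then obtain C where C: "\<And>p. p \<in> ?parts \<Longrightarrow> C p > 0"
    "\<And>p. p \<in> ?parts \<Longrightarrow> eventually (\<lambda>x. infdist x (feasible P) \<le> C p * piece_residual P xb (fst p) (snd p) x) (nhds xb)"
    by metis
  define N where "N p = real (card (Ig P xb) + card (piece_index P xb (fst p) (snd p)))" for p
  define \<alpha> where "\<alpha> = 1 + (\<Sum>p\<in>?parts. C p * N p)"
  have CN: "C p * N p \<ge> 0" if "p \<in> ?parts" for p using C(1)[OF that] by (simp add: N_def)
  then have \<alpha>: "\<alpha> > 0" by (simp add: \<alpha>_def add_pos_nonneg sum_nonneg)
  have all: "eventually (\<lambda>x. \<forall>p\<in>?parts. infdist x (feasible P) \<le> C p * piece_residual P xb (fst p) (snd p) x) (nhds xb)"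
    using finite_parts C(2) by (intro eventually_ball_finite) auto
  have cont: "isCont (swG P k) xb" "isCont (swH P k) xb" if "k \<in> {1..num_switch P}" for k
    using assms(1) that twice_continuously_differentiable_grad(1) unfolding smooth_data_def gderiv_def
    by (blast intro: has_derivative_continuous)+
  have evG: "eventually (\<lambda>x. \<forall>k\<in>IG P xb. \<bar>swG P k x\<bar> < \<bar>swH P k x\<bar>) (nhds xb)"
    using cont by (intro eventually_ball_finite ballI eventually_abs_less finite_index_sets) (auto simp: IG_def)
  have evH: "eventually (\<lambda>x. \<forall>k\<in>IH P xb. \<bar>swH P k x\<bar> < \<bar>swG P k x\<bar>) (nhds xb)"
    using cont by (intro eventually_ball_finite ballI eventually_abs_less finite_index_sets) (auto simp: IH_def)
  have "eventually (\<lambda>x. infdist x (feasible P) \<le> \<alpha> * ?R x) (nhds xb)"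
    using all evG evH
  proof eventually_elim
    case (elim x)
    \<comment> \<open>The branch adapted to \<open>x\<close>; on \<open>IG\<close> and \<open>IH\<close> the imposed function is the smaller one near \<open>xb\<close> anyway.\<close>
    define \<beta>1 where "\<beta>1 = {k \<in> IGH P xb. \<bar>swG P k x\<bar> \<le> \<bar>swH P k x\<bar>}"
    define \<beta>2 where "\<beta>2 = IGH P xb - \<beta>1"
    have part: "(\<beta>1, \<beta>2) \<in> ?parts" by (auto simp: bipartitions_def \<beta>1_def \<beta>2_def)
    have "piece_residual P xb \<beta>1 \<beta>2 x \<le> N (\<beta>1, \<beta>2) * ?R x"
      unfolding N_def fst_conv snd_conv of_nat_add[symmetric]
      using elim(2,3) by (intro piece_residual_le[OF part]) (auto simp: \<beta>1_def \<beta>2_def less_imp_le)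
    then have "C (\<beta>1, \<beta>2) * piece_residual P xb \<beta>1 \<beta>2 x \<le> C (\<beta>1, \<beta>2) * (N (\<beta>1, \<beta>2) * ?R x)"
      using C(1)[OF part] by (intro mult_left_mono) auto
    also have "\<dots> = (C (\<beta>1, \<beta>2) * N (\<beta>1, \<beta>2)) * ?R x" by (simp only: mult.assoc)
    also have "\<dots> \<le> \<alpha> * ?R x"
    proof (rule mult_right_mono)
      show "C (\<beta>1, \<beta>2) * N (\<beta>1, \<beta>2) \<le> \<alpha>"
        using member_le_sum[OF part, of "\<lambda>p. C p * N p"] CN finite_parts by (simp add: \<alpha>_def)
    qed (auto intro!: sum_nonneg add_nonneg_nonneg)
    finally show ?case using bspec[OF elim(1) part] by simp
  qed
  then show ?thesis
    using \<alpha> unfolding local_error_bound_def eventually_nhds_metric dist_norm by blast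
qed

end
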